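(* Let $h:\mathbb T\to\mathbb T$ be an orientation-preserving homeomorphism fixing $-1,\mathrm i,1$ with $s_h\in\mathcal P_0$. Then for every $e=(a,b)\in E$, $$\vartheta_h(e)=-\log\Lambda_h(e)=-\frac12\,\mathrm{length}(h(e)),$$ where $\mathrm{length}(h(e))$ is the signed hyperbolic length of the part of the geodesic $h(e)=(h(a),h(b))$ between the horocycles centered at $h(a)$ and $h(b)$ in the decoration of $h(V)$ determined by $h$.
   Context: Farey tessellation: $\mathbb D$ is the unit disk with its hyperbolic metric, $\mathbb T=\partial\mathbb D$, and for $a\ne b\in\mathbb T$, $(a,b)$ denotes the unoriented hyperbolic geodesic with endpoints $a,b$. The Farey tessellation $\mathfrak F$ is the ideal triangulation of $\mathbb D$ obtained from the ideal triangle with vertices $1,\mathrm i,-1$ by repeated hyperbolic reflections across edges; $V$ is its vertex set, $E$ its edge set. The Cayley map $\mathfrak c(z)=-\mathrm i\frac{z+1}{z-1}$ maps $\mathbb D$ onto the upper half-plane $\mathbb H$, with $-1\mapsto0$, $1\mapsto\infty$, $\mathrm i\mapsto-1$, and $\mathfrak c(V)=\mathbb Q\cup\{\infty\}$. For $e\in E$, $Q_e$ is the union of the two triangles of $\mathfrak F$ having $e$ as an edge, with vertices $(a,b,c,d)$ counterclockwise, $e=(a,c)$. For $v\in V$, $\mathrm{fan}(v)$ is the set of edges incident to $v$, indexed $(e_n)_{n\in\mathbb Z}$ so that under a Möbius map $\mathbb D\to\mathbb H$ sending $v$ to $\infty$ the $e_n$ become equally spaced vertical lines with $n$ increasing from left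 to right. Shears: $s_h(e)=\log\mathrm{cr}(h(a),h(b),h(c),h(d))$ where $Q_e=(a,b,c,d)$, $e=(a,c)$, $\mathrm{cr}(a,b,c,d)=\frac{(b-a)(d-c)}{(c-b)(d-a)}$. $\mathcal P$ is the set of $s:E\to\mathbb R$ such that for every $v\in V$, $\mathrm{fan}(v)=(e_n)$, both limits $\lim_n\sum_{k=-n}^{-1}s(e_k)$ and $\lim_n\sum_{k=0}^n s(e_k)$ exist in $\mathbb R$; $\mathcal P_0\subset\mathcal P$ is the subset where moreover $\sum_{k\in\mathbb Z}s(e_k)=0$ for every $v$. For $s\in\mathcal P$ and $e\in\mathrm{fan}(v)$, $p_{s,v}(e\pm)$ is the sum of $s(e')$ over $e'\in\mathrm{fan}(v)$ of strictly larger ($+$) or strictly smaller ($-$) index than $e$; for $e=(a,b)$, $\Psi(s)(e)=\frac14(p_{s,a}(e-)-p_{s,a}(e+)+p_{s,b}(e-)-p_{s,b}(e+))$; and $\vartheta_h=\Psi(s_h)$. If $s_h\in\mathcal P_0$ then $h$ is differentiable at all points of $V$ (with nonzero derivative). Decoration determined by $h$: let $\varphi=\mathfrak c\circ h\circ\mathfrak c^{-1}$ (it fixes $-1,0,\infty$). In $\mathbb H$, the horocycle at $\varphi(p/q)$ ($p,q$ coprime, $q\ge1$) is the one of Euclidean diameter $|\varphi'(p/q)|q^{-2}$, and the horocycle at $\infty$ is $\{\mathrm{Im}\,z=|\varphi'(\infty)|^{-1}\}$, where $\varphi'(\infty):=\tilde\varphi'(0)$, $\tilde\varphi(x)=-1/\varphi(-1/x)$.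 Pulling back by $\mathfrak c$ gives a horocycle $\rho_a$ in $\mathbb D$ centered at $h(a)$ for each $a\in V$. For $e=(a,b)\in E$, $\mathrm{length}(h(e))$ is the signed hyperbolic distance between $\rho_a\cap h(e)$ and $\rho_b\cap h(e)$, positive if $\rho_a\cap\rho_b=\emptyset$ (zero if tangent, negative if they overlap), and $\log\Lambda_h(e):=\frac12\mathrm{length}(h(e))$. *)

theory Defs
  imports "HOL-Analysis.Analysis"
begin

section \<open>The hyperbolic disk\<close>

text \<open>The distance of the metric \<open>2 |dz| / (1 - |z|^2)\<close> of curvature \<open>-1\<close> on the unit disk.\<close>

definition hyp_dist :: "complex \<Rightarrow> complex \<Rightarrow> real" where
  "hyp_dist z w =
     arcosh (1 + 2 * (cmod (z - w))\<^sup>2 / ((1 - (cmod z)\<^sup>2) * (1 - (cmod w)\<^sup>2)))"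

text \<open>
  For distinct points \<open>a\<close>, \<open>b\<close> of the unit circle with \<open>a + b \<noteq> 0\<close>, the geodesic with endpoints
  \<open>a\<close>, \<open>b\<close> lies on the Euclidean circle through \<open>a\<close>, \<open>b\<close> orthogonal to the unit circle. Its
  center is the intersection of the tangents at \<open>a\<close> and \<open>b\<close>, and orthogonality means
  \<open>|center|^2 = 1 + radius^2\<close>. If \<open>a + b = 0\<close>, the geodesic is a diameter.
\<close>

definition orth_center :: "complex \<Rightarrow> complex \<Rightarrow> complex" where
  "orth_center a b = 2 * a * b / (a + b)"

definition orth_radius :: "complex \<Rightarrow> complex \<Rightarrow> real" where
  "orth_radius a b = sqrt ((cmod (orth_center a b))\<^sup>2 - 1)"

definition geodesic :: "complex \<Rightarrow> complex \<Rightarrow> complex set" where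
  "geodesic a b =
     (if a + b = 0 then {of_real t * a | t. - 1 < t \<and> t < 1}
      else ball 0 1 \<inter> sphere (orth_center a b) (orth_radius a b))"

text \<open>
  The hyperbolic reflection across \<open>geodesic a b\<close>, as a map of the closed disk: Euclidean
  reflection in the line through \<open>a\<close> and \<open>-a\<close>, respectively inversion in the orthogonal circle.
\<close>

definition hyp_reflection :: "complex \<Rightarrow> complex \<Rightarrow> complex \<Rightarrow> complex" where
  "hyp_reflection a b z =
     (if a + b = 0 then a\<^sup>2 * cnj z
      else orth_center a b + of_real ((orth_radius a b)\<^sup>2) / cnj (z - orth_center a b))"

text \<open>\<open>ccw a b c\<close>: the triangle \<open>a\<close>, \<open>b\<close>, \<open>c\<close> is positively oriented. For points of the unit
  circle this says that \<open>a\<close>, \<open>b\<close>, \<open>c\<close> are distinct and in counterclockwise cyclic order.\<close>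

definition ccw :: "complex \<Rightarrow> complex \<Rightarrow> complex \<Rightarrow> bool" where
  "ccw a b c \<longleftrightarrow> Im (cnj (b - a) * (c - a)) > 0"

definition orientation_preserving_circle_homeo :: "(complex \<Rightarrow> complex) \<Rightarrow> bool" where
  "orientation_preserving_circle_homeo h \<longleftrightarrow>
     (\<exists>g. homeomorphism (sphere 0 1) (sphere 0 1) h g) \<and>
     (\<forall>a\<in>sphere 0 1. \<forall>b\<in>sphere 0 1. \<forall>c\<in>sphere 0 1. ccw a b c \<longrightarrow> ccw (h a) (h b) (h c))"


section \<open>The Farey tessellation\<close>

text \<open>
  Ideal triangles and geodesics are encoded by their sets of ideal vertices, respectively
  endpoints, on the unit circle; so the unoriented geodesic \<open>(a, b)\<close> is \<open>{a, b}\<close>.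
\<close>

inductive_set farey_triangles :: "complex set set" where
  base: "{1, \<i>, - 1} \<in> farey_triangles"
| reflect: "\<lbrakk>T \<in> farey_triangles; a \<in> T; b \<in> T; a \<noteq> b\<rbrakk>
    \<Longrightarrow> hyp_reflection a b ` T \<in> farey_triangles"

definition farey_vertices :: "complex set" where
  "farey_vertices = \<Union> farey_triangles"

definition farey_edges :: "complex set set" where
  "farey_edges = {{a, b} | a b. a \<noteq> b \<and> (\<exists>T\<in>farey_triangles. a \<in> T \<and> b \<in> T)}"

definition farey_quad :: "complex set \<Rightarrow> complex \<Rightarrow> complex \<Rightarrow> complex \<Rightarrow> complex \<Rightarrow> bool" where
  "farey_quad e a b c d \<longleftrightarrow>
     e = {a, c} \<and> {a, b, c} \<in> farey_triangles \<and> {a, c, d} \<in> farey_triangles \<and>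
     ccw a b c \<and> ccw a c d"

definition farey_fan :: "complex \<Rightarrow> complex set set" where
  "farey_fan v = {e \<in> farey_edges. v \<in> e}"

text \<open>\<open>z \<mapsto> (A z + B) / (C z + D)\<close> maps the disk onto the upper half-plane and has its pole at \<open>v\<close>.\<close>

definition moebius_to_H :: "complex \<Rightarrow> (complex \<Rightarrow> complex) \<Rightarrow> bool" where
  "moebius_to_H v M \<longleftrightarrow>
     (\<exists>A B C D. A * D - B * C \<noteq> 0 \<and> M = (\<lambda>z. (A * z + B) / (C * z + D)) \<and>
        C * v + D = 0 \<and> M ` ball 0 1 = {z. Im z > 0})"

text \<open>
  A map \<open>M\<close> as above takes the geodesic \<open>{v, w}\<close> to the vertical line over the real number \<open>M w\<close>.
\<close>

definition fan_indexing :: "complex \<Rightarrow> (int \<Rightarrow> complex set) \<Rightarrow> bool" where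
  "fan_indexing v f \<longleftrightarrow>
     bij_betw f UNIV (farey_fan v) \<and>
     (\<exists>M x \<delta>. moebius_to_H v M \<and> \<delta> > 0 \<and>
        (\<forall>n. \<exists>w. f n = {v, w} \<and> M w = of_real (x + of_int n * \<delta>)))"

text \<open>
  The indexing is unique up to a shift of the index; none of the notions below depends on the
  choice of the shift.
\<close>

definition fan :: "complex \<Rightarrow> int \<Rightarrow> complex set" where
  "fan v = (SOME f. fan_indexing v f)"


section \<open>Shears\<close>

definition cr :: "complex \<Rightarrow> complex \<Rightarrow> complex \<Rightarrow> complex \<Rightarrow> complex" where
  "cr a b c d = ((b - a) * (d - c)) / ((c - b) * (d - a))"

text \<open>
  An edge has two labelings \<open>(a, b, c, d)\<close> and \<open>(c, d, a, b)\<close> of its quadrilateral, with the same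
  cross ratio. The cross ratio is a positive real number for points of the circle in
  counterclockwise order.
\<close>

definition shear :: "(complex \<Rightarrow> complex) \<Rightarrow> complex set \<Rightarrow> real" where
  "shear h e =
     (THE s. \<exists>a b c d. farey_quad e a b c d \<and> s = ln (Re (cr (h a) (h b) (h c) (h d))))"

definition P_space :: "(complex set \<Rightarrow> real) set" where
  "P_space = {s. \<forall>v\<in>farey_vertices.
     summable (\<lambda>k. s (fan v (- int (Suc k)))) \<and> summable (\<lambda>k. s (fan v (int k)))}"

definition P0_space :: "(complex set \<Rightarrow> real) set" where
  "P0_space = {s \<in> P_space. \<forall>v\<in>farey_vertices.
     (\<Sum>k. s (fan v (- int (Suc k)))) + (\<Sum>k. s (fan v (int k))) = 0}"

definition fan_index :: "complex \<Rightarrow> complex set \<Rightarrow> int" where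
  "fan_index v e = (THE n. fan v n = e)"

definition p_plus :: "(complex set \<Rightarrow> real) \<Rightarrow> complex \<Rightarrow> complex set \<Rightarrow> real" where
  "p_plus s v e = (\<Sum>k. s (fan v (fan_index v e + int (Suc k))))"

definition p_minus :: "(complex set \<Rightarrow> real) \<Rightarrow> complex \<Rightarrow> complex set \<Rightarrow> real" where
  "p_minus s v e = (\<Sum>k. s (fan v (fan_index v e - int (Suc k))))"

definition Psi :: "(complex set \<Rightarrow> real) \<Rightarrow> complex set \<Rightarrow> real" where
  "Psi s e = 1 / 4 * (\<Sum>v\<in>e. p_minus s v e - p_plus s v e)"

definition vartheta :: "(complex \<Rightarrow> complex) \<Rightarrow> complex set \<Rightarrow> real" where
  "vartheta h = Psi (shear h)"


section \<open>The decoration determined by a circle homeomorphism\<close>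

definition cayley :: "complex \<Rightarrow> complex" where
  "cayley z = - \<i> * ((z + 1) / (z - 1))"

definition cayley_inv :: "complex \<Rightarrow> complex" where
  "cayley_inv w = (w - \<i>) / (w + \<i>)"

text \<open>
  The finite part of \<open>\<phi> = cayley \<circ> h \<circ> cayley_inv\<close>. It is real-valued if \<open>h\<close> is injective on the
  circle and fixes \<open>1\<close>, which corresponds to \<open>\<infinity>\<close>.
\<close>

definition line_map :: "(complex \<Rightarrow> complex) \<Rightarrow> real \<Rightarrow> real" where
  "line_map h x = Re (cayley (h (cayley_inv (of_real x))))"

text \<open>
  With the convention \<open>1 / 0 = 0\<close>, and since \<open>\<phi>\<close> fixes \<open>0\<close>, the value at \<open>0\<close> is \<open>0\<close>. This is
  the value \<open>- 1 / \<infinity>\<close> given by \<open>\<phi> \<infinity> = \<infinity>\<close>.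
\<close>

definition line_map_inf :: "(complex \<Rightarrow> complex) \<Rightarrow> real \<Rightarrow> real" where
  "line_map_inf h x = - 1 / line_map h (- 1 / x)"

definition H_horocycle :: "real \<Rightarrow> real \<Rightarrow> complex set" where
  "H_horocycle x \<delta> = {z. Im z > 0} \<inter> sphere (Complex x (\<delta> / 2)) (\<delta> / 2)"

text \<open>
  The horocycle centered at \<open>h a\<close>, for a Farey vertex \<open>a\<close>. If \<open>a \<noteq> 1\<close> then \<open>cayley a\<close> is rational,
  so \<open>p\<close> and \<open>q\<close> exist and are unique.
\<close>

definition decoration :: "(complex \<Rightarrow> complex) \<Rightarrow> complex \<Rightarrow> complex set" where
  "decoration h a =
     (if a = 1 then {z \<in> ball 0 1. Im (cayley z) = 1 / \<bar>deriv (line_map_inf h) 0\<bar>}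
      else {z \<in> ball 0 1. \<exists>p q :: int. coprime p q \<and> q \<ge> 1 \<and>
              cayley a = of_real (of_int p / of_int q) \<and>
              cayley z \<in> H_horocycle (line_map h (of_int p / of_int q))
                           (\<bar>deriv (line_map h) (of_int p / of_int q)\<bar> / (of_int q)\<^sup>2)})"

text \<open>
  A geodesic ending at the center of a horocycle meets it in one point. Horocycles with distinct
  centers bound disjoint horodisks, tangent ones or overlapping ones according to whether they
  meet in \<open>0\<close>, \<open>1\<close> or \<open>2\<close> points; in the tangent case the distance below vanishes.
\<close>

definition signed_length :: "(complex \<Rightarrow> complex) \<Rightarrow> complex \<Rightarrow> complex \<Rightarrow> real" where
  "signed_length h a b =
     (let g = geodesic (h a) (h b);
          l = hyp_dist (the_elem (decoration h a \<inter> g)) (the_elem (decoration h b \<inter> g))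
      in if decoration h a \<inter> decoration h b = {} then l else - l)"

definition Lambda :: "(complex \<Rightarrow> complex) \<Rightarrow> complex \<Rightarrow> complex \<Rightarrow> real" where
  "Lambda h a b = exp (1 / 2 * signed_length h a b)"

end

theory Submission
  imports Defs "HOL-Real_Asymp.Real_Asymp"
begin

text \<open>
  Represent a point of the circle by a nonzero vector \<open>u\<close> of the plane, up to scaling. The edges of
  the Farey tessellation are then the pairs of integer vectors of determinant \<open>1\<close>, the neighbours
  of \<open>u\<close> are the \<open>w + k u\<close>, and cross ratios are quotients of products of determinants. Let \<open>U\<close>
  and \<open>W\<close> represent the images of \<open>u\<close> and \<open>w\<close> under \<open>h\<close>.

  In a coordinate with \<open>U\<close> at infinity, the shears of the fan at \<open>u\<close> are the differences of the
  logarithms of consecutive gaps between the images of the neighbours of \<open>u\<close>. So \<open>s \<in> P0\<close> means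
  that these logarithms have one and the same limit \<open>L\<^sub>u\<close> in both directions. By monotonicity the
  map then grows linearly in this coordinate, with slope \<open>exp L\<^sub>u\<close>. This is the differentiability
  of \<open>h\<close> at \<open>u\<close> and determines the size of the horocycle. On the one hand, the signed length of
  the edge \<open>u w\<close> is therefore \<open>2 ln \<bar>det U W\<bar> + L\<^sub>u + L\<^sub>w\<close>. On the other hand, \<open>4 \<vartheta>\<close> is the sum
  of four logarithmic gaps, reduced by \<open>2 L\<^sub>u + 2 L\<^sub>w\<close>. The four gaps belong to the same two
  triangles, seen from \<open>u\<close> and from \<open>w\<close>, and their logarithms sum to \<open>- 4 ln \<bar>det U W\<bar>\<close>.
\<close>

section \<open>Points of the circle as vectors\<close>

definition det2 :: "complex \<Rightarrow> complex \<Rightarrow> real" where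
  "det2 u w = Im (cnj u * w)"

text \<open>The Cayley map sends this point to \<open>Re u / Im u\<close>, and
  \<open>Im u = 0\<close> gives the point \<open>1\<close> over infinity. Real multiples of
  \<open>u\<close> give the same point, and integer vectors give the rational points and
  infinity.\<close>

definition circ :: "complex \<Rightarrow> complex" where
  "circ u = cnj u / u"

definition gint :: "complex set" where
  "gint = {z. Re z \<in> \<int> \<and> Im z \<in> \<int>}"

lemma det2_eq: "det2 u w = Re u * Im w - Im u * Re w"
  by (simp add: det2_def)

lemma det2_simps [simp]:
  "det2 u u = 0"
  "det2 (u + u') w = det2 u w + det2 u' w"
  "det2 u (w + w') = det2 u w + det2 u w'"
  "det2 (u - u') w = det2 u w - det2 u' w"
  "det2 u (w - w') = det2 u w - det2 u w'"
  "det2 (- u) w = - det2 u w"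
  "det2 u (- w) = - det2 u w"
  "det2 (of_int k * u) w = of_int k * det2 u w"
  "det2 u (of_int k * w) = of_int k * det2 u w"
  "det2 (of_real r * u) w = r * det2 u w"
  "det2 u (of_real r * w) = r * det2 u w"
  "det2 0 w = 0" "det2 u 0 = 0"
  by (simp_all add: det2_eq algebra_simps)

lemma det2_swap: "det2 w u = - det2 u w"
  by (simp add: det2_eq algebra_simps)

text \<open>Cramer's rule. For integer vectors the coefficients are integers.\<close>

lemma basis_expansion:
  assumes "det2 u w = 1"
  shows "y = of_real (det2 y w) * u + of_real (det2 u y) * w"
proof -
  have "Re y * det2 u w = det2 y w * Re u + det2 u y * Re w"
    "Im y * det2 u w = det2 y w * Im u + det2 u y * Im w"
    unfolding det2_eq by algebra+
  with assms show ?thesis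
    by (simp add: complex_eq_iff)
qed

lemma det2_gint: "u \<in> gint \<Longrightarrow> w \<in> gint \<Longrightarrow> det2 u w \<in> \<int>"
  by (auto simp: det2_eq gint_def)

lemma gint_simps [simp]:
  "u \<in> gint \<Longrightarrow> w \<in> gint \<Longrightarrow> u + w \<in> gint"
  "u \<in> gint \<Longrightarrow> w \<in> gint \<Longrightarrow> u - w \<in> gint"
  "- u \<in> gint \<longleftrightarrow> u \<in> gint"
  "u \<in> gint \<Longrightarrow> of_int k * u \<in> gint"
  by (auto simp: gint_def)

lemma circ_minus [simp]: "circ (- u) = circ u"
  by (simp add: circ_def)

lemma circ_eqI: "u \<noteq> 0 \<Longrightarrow> cnj u = z * u \<Longrightarrow> circ u = z"
  by (simp add: circ_def)

lemma norm_circ [simp]: "u \<noteq> 0 \<Longrightarrow> cmod (circ u) = 1"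
  by (simp add: circ_def norm_divide)

text \<open>The numerator \<open>cnj u * w - cnj w * u\<close> is a number minus its conjugate. This
  turns differences on the circle into determinants; in cross ratios the denominators
  \<open>u * w\<close> cancel.\<close>

lemma circ_diff:
  assumes "u \<noteq> 0" "w \<noteq> 0"
  shows "circ u - circ w = 2 * \<i> * of_real (det2 u w) / (u * w)"
proof -
  have "circ u - circ w = (cnj u * w - cnj w * u) / (u * w)"
    using assms by (simp add: circ_def field_simps)
  also have "cnj u * w - cnj w * u = 2 * \<i> * of_real (det2 u w)"
    by (simp add: det2_def complex_eq_iff algebra_simps)
  finally show ?thesis .
qed

lemma circ_eq_iff: "u \<noteq> 0 \<Longrightarrow> w \<noteq> 0 \<Longrightarrow> circ u = circ w \<longleftrightarrow> det2 u w = 0"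
  using circ_diff[of u w] by (auto simp: right_minus_eq[symmetric, of "circ u"] simp del: right_minus_eq)

text \<open>Each vector occurs twice in the product of determinants, so its sign does not depend on
  the representatives. The proof rewrites two differences by \<open>circ_diff\<close> and splits off
  positive squared norms.\<close>

lemma ccw_circ:
  assumes "u \<noteq> 0" "w \<noteq> 0" "x \<noteq> 0"
  shows "ccw (circ u) (circ w) (circ x) \<longleftrightarrow> det2 u w * det2 w x * det2 x u > 0"
proof -
  have "cnj (circ w - circ u) * (circ x - circ u)
      = of_real (4 * det2 w u * det2 x u) / (cnj w * x * (u * cnj u))"
    unfolding circ_diff[OF assms(2,1)] circ_diff[OF assms(3,1)] using assms
    by (simp add: mult_ac)
  also have "\<dots> = of_real (4 * det2 w u * det2 x u) * (w * cnj x) / ((w * cnj w) * (x * cnj x) * (u * cnj u))"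
    using assms by (simp add: mult_ac)
  also have "\<dots> = of_real (4 * det2 w u * det2 x u / ((cmod w)\<^sup>2 * (cmod x)\<^sup>2 * (cmod u)\<^sup>2)) * (w * cnj x)"
    by (simp only: complex_norm_square[symmetric] of_real_mult[symmetric] of_real_divide) simp
  finally have "Im (cnj (circ w - circ u) * (circ x - circ u)) =
      4 * det2 w u * det2 x u / ((cmod w)\<^sup>2 * (cmod x)\<^sup>2 * (cmod u)\<^sup>2) * Im (w * cnj x)"
    by (simp only: Re_complex_of_real Im_complex_of_real times_complex.sel mult_zero_left add_0_right)
  also have "Im (w * cnj x) = - det2 w x"
    by (simp add: det2_eq)
  also have "4 * det2 w u * det2 x u / ((cmod w)\<^sup>2 * (cmod x)\<^sup>2 * (cmod u)\<^sup>2) * (- det2 w x)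
     = 4 * (det2 u w * det2 w x * det2 x u) / ((cmod w)\<^sup>2 * (cmod x)\<^sup>2 * (cmod u)\<^sup>2)"
    by (simp add: det2_swap[of w u] algebra_simps)
  finally have *: "Im (cnj (circ w - circ u) * (circ x - circ u)) =
    4 * (det2 u w * det2 w x * det2 x u) / ((cmod w)\<^sup>2 * (cmod x)\<^sup>2 * (cmod u)\<^sup>2)" .
  have "(cmod w)\<^sup>2 * (cmod x)\<^sup>2 * (cmod u)\<^sup>2 > 0"
    using assms by simp
  then show ?thesis unfolding ccw_def * by (simp add: zero_less_divide_iff mult.assoc)
qed

lemma cr_circ:
  assumes "a \<noteq> 0" "b \<noteq> 0" "c \<noteq> 0" "d \<noteq> 0"
  shows "cr (circ a) (circ b) (circ c) (circ d)
    = of_real (det2 b a * det2 d c / (det2 c b * det2 d a))"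
  using assms by (simp add: cr_def circ_diff divide_simps)

section \<open>Reflections across geodesics\<close>

lemma orth_circle:
  assumes "cmod a = 1" "cmod b = 1" "a + b \<noteq> 0"
  shows "orth_center a b * (a + b) = 2 * a * b" "cnj (orth_center a b) * (a + b) = 2"
    "(orth_radius a b)\<^sup>2 = (cmod (orth_center a b))\<^sup>2 - 1" "orth_radius a b \<ge> 0"
proof -
  have nz: "a \<noteq> 0" "b \<noteq> 0" using assms by auto
  have cn: "cnj a = 1 / a" "cnj b = 1 / b"
    using assms by (simp_all add: divide_conv_cnj)
  define c where "c = orth_center a b"
  have c: "c * (a + b) = 2 * a * b" and cc: "cnj c * (a + b) = 2"
    using assms(3) nz by (simp_all add: c_def orth_center_def cn field_simps)
  \<comment> \<open>Since \<open>cmod (a + b)\<close> is at most 2, this forces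
    \<open>cmod c\<close> to be at least 1, so the square root in \<open>orth_radius\<close> has a
    nonnegative argument.\<close>
  have "(cmod c)\<^sup>2 * (cmod (a + b))\<^sup>2 = 4"
    using arg_cong[OF c, of cmod] assms by (simp add: norm_mult power_mult_distrib[symmetric])
  moreover have "(cmod (a + b))\<^sup>2 \<le> 4"
    using norm_triangle_ineq[of a b] assms power_mono[of "cmod (a + b)" 2 2] by simp
  moreover have "(cmod (a + b))\<^sup>2 > 0" using assms(3) by simp
  ultimately have "\<not> (cmod c)\<^sup>2 < 1"
    using mult_strict_right_mono[of "(cmod c)\<^sup>2" 1 "(cmod (a + b))\<^sup>2"] by auto
  then show "orth_center a b * (a + b) = 2 * a * b" "cnj (orth_center a b) * (a + b) = 2"
    "(orth_radius a b)\<^sup>2 = (cmod (orth_center a b))\<^sup>2 - 1" "orth_radius a b \<ge> 0"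
    using c cc by (simp_all add: orth_radius_def c_def[symmetric])
qed

text \<open>Points \<open>z\<close>, \<open>z'\<close> of the circle are exchanged by the reflection iff they separate \<open>a\<close>, \<open>b\<close>
  harmonically.\<close>

lemma hyp_reflection_circle:
  assumes "cmod a = 1" "cmod b = 1" "cmod z = 1" "a \<noteq> b"
    and harm: "(z - a) * (z' - b) + (z - b) * (z' - a) = 0"
  shows "hyp_reflection a b z = z'"
proof -
  have nz: "a \<noteq> 0" "b \<noteq> 0" "z \<noteq> 0" using assms by auto
  have cn: "cnj a = 1 / a" "cnj b = 1 / b" "cnj z = 1 / z"
    using assms by (simp_all add: divide_conv_cnj)
  have eq: "z' * (a + b - 2 * z) = 2 * a * b - (a + b) * z"
    using harm by algebra
  \<comment> \<open>Otherwise \<open>z\<close> would be the midpoint of the chord from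
    \<open>a\<close> to \<open>b\<close>, and \<open>eq\<close> would force
    \<open>a = b\<close>.\<close>
  have ne: "a + b - 2 * z \<noteq> 0"
  proof
    assume "a + b - 2 * z = 0"
    with eq have "2 * a * b - (a + b) * z = 0" "2 * z = a + b" by auto
    then have "(a - b)\<^sup>2 = 0" by algebra
    with \<open>a \<noteq> b\<close> show False by simp
  qed
  show ?thesis
  proof (cases "a + b = 0")
    case True
    then have "b = - a" by (simp add: eq_neg_iff_add_eq_0 add.commute)
    with eq nz have "z' * z = a\<^sup>2" by (simp add: power2_eq_square algebra_simps)
    with True nz show ?thesis by (simp add: hyp_reflection_def cn field_simps)
  next
    case False
    define c where "c = orth_center a b"
    have c: "c * (a + b) = 2 * a * b" and cc: "cnj c * (a + b) = 2"
      and "(orth_radius a b)\<^sup>2 = (cmod c)\<^sup>2 - 1"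
      using orth_circle[OF assms(1,2) False] by (simp_all add: c_def)
    then have r: "of_real ((orth_radius a b)\<^sup>2) = c * cnj c - 1"
      by (simp add: complex_norm_square[symmetric])
    \<comment> \<open>With \<open>cnj z = 1 / z\<close> the inversion becomes a fractional linear
      map of \<open>z\<close>; the factor \<open>z * (a + b)\<close> clears the
      denominators.\<close>
    have k: "cnj (z - c) * z = 1 - cnj c * z"
      using nz by (simp add: cn algebra_simps)
    then have "cnj (z - c) * (z * (a + b)) = a + b - z * (cnj c * (a + b))"
      by (simp add: mult.assoc[symmetric]) (simp add: algebra_simps)
    then have d: "cnj (z - c) * (z * (a + b)) = a + b - 2 * z"
      unfolding cc by (simp add: mult.commute)
    then have d0: "cnj (z - c) \<noteq> 0" using ne by auto
    have "(c * cnj (z - c) + (c * cnj c - 1) - z' * cnj (z - c)) * (z * (a + b))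
        = c * (a + b) * (cnj (z - c) * z) + (c * cnj c - 1) * (z * (a + b))
          - z' * (cnj (z - c) * (z * (a + b)))"
      by (simp only: ring_distribs mult_ac)
    also have "\<dots> = c * (a + b) - (a + b) * z - z' * (a + b - 2 * z)"
      unfolding k d by (simp only: ring_distribs mult_ac mult_1_right mult_1_left) simp
    also have "\<dots> = 0"
      unfolding c eq by simp
    finally have "(c * cnj (z - c) + (c * cnj c - 1) - z' * cnj (z - c)) * (z * (a + b)) = 0" .
    then have "c * cnj (z - c) + (c * cnj c - 1) = z' * cnj (z - c)"
      using False nz by simp
    then have "c + (c * cnj c - 1) / cnj (z - c) = z'"
      using d0 by (simp only: add_divide_eq_iff nonzero_divide_eq_eq not_False_eq_True)
    then show ?thesis using False
      by (simp only: hyp_reflection_def c_def[symmetric] r if_False)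
  qed
qed

text \<open>The vectors \<open>u + w\<close> and \<open>u - w\<close> give a pair that is harmonic
  to \<open>circ u\<close>, \<open>circ w\<close>. So reflecting a triangle in this side amounts to
  replacing \<open>w\<close> by \<open>- w\<close>.\<close>

lemma hyp_reflection_circ:
  assumes "det2 u w \<noteq> 0"
  shows "hyp_reflection (circ u) (circ w) (circ u) = circ u"
    and "hyp_reflection (circ u) (circ w) (circ w) = circ w"
    and "hyp_reflection (circ u) (circ w) (circ (u + w)) = circ (u - w)"
proof -
  have nz: "u \<noteq> 0" "w \<noteq> 0" using assms by auto
  have ne: "circ u \<noteq> circ w" using assms nz by (simp add: circ_eq_iff)
  have nz2: "u + w \<noteq> 0" "u - w \<noteq> 0"
    using assms det2_simps(1)[of u] by (auto simp: add_eq_0_iff)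
  show "hyp_reflection (circ u) (circ w) (circ u) = circ u"
    "hyp_reflection (circ u) (circ w) (circ w) = circ w"
    using nz ne by (simp_all add: hyp_reflection_circle)
  have "(circ (u + w) - circ u) * (circ (u - w) - circ w)
      + (circ (u + w) - circ w) * (circ (u - w) - circ u) = 0"
    unfolding circ_diff[OF nz2(1) nz(1)] circ_diff[OF nz2(1) nz(2)]
      circ_diff[OF nz2(2) nz(1)] circ_diff[OF nz2(2) nz(2)]
    by (simp add: det2_swap[of w u] mult_ac)
  then show "hyp_reflection (circ u) (circ w) (circ (u + w)) = circ (u - w)"
    using nz ne nz2 by (intro hyp_reflection_circle) simp_all
qed

section \<open>The Farey tessellation and integer vectors\<close>

text \<open>The basis is only required to have determinant \<open>1\<close> or \<open>- 1\<close>, so that each side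
  of a triangle may serve as the pair \<open>u\<close>, \<open>w\<close>.\<close>

definition tri :: "complex \<Rightarrow> complex \<Rightarrow> complex set" where
  "tri u w = {circ u, circ w, circ (u + w)}"

lemma unimodular_nonzero:
  assumes "\<bar>det2 u w\<bar> = 1"
  shows "u \<noteq> 0" "w \<noteq> 0" "u + w \<noteq> 0" "u - w \<noteq> 0"
  using assms det2_simps(1)[of u] by (auto simp: add_eq_0_iff)

text \<open>Any two of \<open>u\<close>, \<open>w\<close>, \<open>u + w\<close>, with suitable
  signs, form a basis whose sum is the third vector. The six cases choose these signs.\<close>

lemma tri_side:
  assumes uw: "u \<in> gint" "w \<in> gint" "\<bar>det2 u w\<bar> = 1" and ab: "a \<in> tri u w" "b \<in> tri u w" "a \<noteq> b"
  obtains (tri_sideI) u' w' where "u' \<in> gint" "w' \<in> gint" "\<bar>det2 u' w'\<bar> = 1" "a = circ u'" "b = circ w'"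
    "tri u w = tri u' w'"
proof -
  have *: thesis if "a = circ u'" "b = circ w'" "{a, b, circ (u' + w')} = tri u w"
    "u' \<in> gint" "w' \<in> gint" "\<bar>det2 u' w'\<bar> = 1" for u' w'
    using that by (intro tri_sideI[of u' w']) (auto simp: tri_def)
  have sw: "det2 w u = - det2 u w" by (rule det2_swap)
  consider "a = circ u" "b = circ w" | "a = circ w" "b = circ u"
    | "a = circ u" "b = circ (u + w)" | "a = circ (u + w)" "b = circ u"
    | "a = circ w" "b = circ (u + w)" | "a = circ (u + w)" "b = circ w"
    using ab by (auto simp: tri_def)
  then show thesis
  proof cases
    case 1 with uw show ?thesis by (intro *[of u w]) (auto simp: tri_def)
  next
    case 2 with uw show ?thesis by (intro *[of w u]) (auto simp: tri_def sw add.commute)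
  next
    case 3 with uw show ?thesis by (intro *[of "- u" "u + w"]) (auto simp: tri_def)
  next
    case 4 with uw show ?thesis by (intro *[of "u + w" "- u"]) (auto simp: tri_def sw)
  next
    case 5 with uw show ?thesis by (intro *[of "- w" "u + w"]) (auto simp: tri_def sw)
  next
    case 6 with uw show ?thesis by (intro *[of "u + w" "- w"]) (auto simp: tri_def)
  qed
qed

lemma hyp_reflection_tri:
  assumes "\<bar>det2 u w\<bar> = 1"
  shows "hyp_reflection (circ u) (circ w) ` tri u w = tri u (- w)"
  using assms hyp_reflection_circ[of u w] by (auto simp: tri_def)

lemma tri_base: "tri 1 (\<i> - 1) = {1, \<i>, - 1}"
proof -
  have "circ 1 = 1" "circ (\<i> - 1) = \<i>" "circ \<i> = - 1"
    by (rule circ_eqI; simp add: complex_eq_iff)+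
  then show ?thesis by (simp add: tri_def)
qed

text \<open>A reflection changes the sign of one basis vector, which preserves integrality and the
  absolute value of the determinant.\<close>

lemma farey_triangles_tri:
  "T \<in> farey_triangles \<Longrightarrow> \<exists>u\<in>gint. \<exists>w\<in>gint. \<bar>det2 u w\<bar> = 1 \<and> T = tri u w"
proof (induction rule: farey_triangles.induct)
  case base
  show ?case
    by (intro bexI[of _ 1] bexI[of _ "\<i> - 1"] conjI tri_base[symmetric]) (auto simp: det2_eq gint_def)
next
  case (reflect T a b)
  then obtain u w where uw: "u \<in> gint" "w \<in> gint" "\<bar>det2 u w\<bar> = 1" and T: "T = tri u w" by blast
  obtain u' w' where uw': "u' \<in> gint" "w' \<in> gint" "\<bar>det2 u' w'\<bar> = 1"
    "a = circ u'" "b = circ w'" "tri u w = tri u' w'"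
    using reflect.hyps by (auto intro: tri_side[OF uw, of a b] simp: T)
  have "hyp_reflection a b ` T = tri u' (- w')"
    using hyp_reflection_tri uw' T by simp
  with uw' show ?case
    by (intro bexI[of _ u'] bexI[of _ "- w'"]) auto
qed

lemma tri_neg_mem:
  assumes "tri u w \<in> farey_triangles" "\<bar>det2 u w\<bar> = 1"
  shows "tri u (- w) \<in> farey_triangles"
proof -
  have "circ u \<noteq> circ w"
    using assms(2) unimodular_nonzero[OF assms(2)] by (auto simp: circ_eq_iff)
  then show ?thesis
    using farey_triangles.reflect[OF assms(1), of "circ u" "circ w"]
      hyp_reflection_tri[OF assms(2)] by (simp add: tri_def)
qed

lemma tri_commute: "tri u w = tri w u"
  by (auto simp: tri_def add.commute)

lemma tri_minus_minus: "tri (- u) (- w) = tri u w"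
  using circ_minus[of "u + w"] by (simp add: tri_def)

lemma tri_add: "tri u (- (u + w)) = tri u w"
  using circ_minus[of w] circ_minus[of "u + w"] by (auto simp: tri_def)

lemma tri_neg_iff:
  "\<bar>det2 u w\<bar> = 1 \<Longrightarrow> tri u (- w) \<in> farey_triangles \<longleftrightarrow> tri u w \<in> farey_triangles"
  using tri_neg_mem[of u w] tri_neg_mem[of u "- w"] by auto

text \<open>The triangle \<open>tri u y\<close> is also \<open>tri u (- (u + y))\<close>; reflecting
  it in the side \<open>u\<close>, \<open>u + y\<close> gives \<open>tri u (u + y)\<close>, the next
  triangle around \<open>circ u\<close>.\<close>

lemma tri_shift_iff:
  assumes "\<bar>det2 u w\<bar> = 1"
  shows "tri u (w + of_int k * u) \<in> farey_triangles \<longleftrightarrow> tri u w \<in> farey_triangles"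
proof -
  have step: "tri u (y + u) \<in> farey_triangles \<longleftrightarrow> tri u y \<in> farey_triangles" if "\<bar>det2 u y\<bar> = 1" for y
    using tri_neg_iff[of u "u + y"] tri_add[of u y] that by (simp add: add.commute)
  show ?thesis
  proof (induction k rule: int_induct[where k = 0])
    case (step1 i)
    have "w + of_int (i + 1) * u = w + of_int i * u + u" by (simp add: algebra_simps)
    with step1 step[of "w + of_int i * u"] assms show ?case by (simp add: add.assoc)
  next
    case (step2 i)
    have "w + of_int i * u = w + of_int (i - 1) * u + u" by (simp add: algebra_simps)
    with step2 step[of "w + of_int (i - 1) * u"] assms show ?case by (simp add: add.assoc del: of_int_diff)
  qed simp
qed

text \<open>The Euclidean algorithm on the denominators \<open>q\<close>, \<open>s\<close>: adding a
  multiple of one vector to the other only turns the triangle around a vertex, until one denominator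
  is 0.\<close>

lemma tri_farey_int:
  fixes p q r s :: int
  assumes "\<bar>p * s - q * r\<bar> = 1"
  shows "tri (Complex p q) (Complex r s) \<in> farey_triangles"
  using assms
proof (induction "nat (\<bar>q\<bar> + \<bar>s\<bar>)" arbitrary: p q r s rule: less_induct)
  case less
  have shift: "tri (Complex p q) (Complex r s) \<in> farey_triangles \<longleftrightarrow>
      tri (Complex p q) (Complex (r + k * p) (s + k * q)) \<in> farey_triangles"
    if "\<bar>p * s - q * r\<bar> = 1" for p q r s k :: int
  proof -
    have "det2 (Complex p q) (Complex r s) = of_int (p * s - q * r)"
      by (simp add: det2_eq)
    with that have "\<bar>det2 (Complex p q) (Complex r s)\<bar> = 1"
      by (metis of_int_1 of_int_abs)
    moreover have "Complex (r + k * p) (s + k * q) = Complex r s + of_int k * Complex p q"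
      by (simp add: complex_eq_iff)
    ultimately show ?thesis using tri_shift_iff by simp
  qed
  \<comment> \<open>If a denominator is 0 then \<open>p\<close> and \<open>s\<close> are 1 or -1,
    and a shift along the real vector removes \<open>r\<close>. What remains is, up to signs, a
    neighbour of the base triangle.\<close>
  have real: "tri (Complex p 0) (Complex r s) \<in> farey_triangles" if "\<bar>p * s\<bar> = 1" for p r s :: int
  proof -
    have ps: "\<bar>p\<bar> = 1" "\<bar>s\<bar> = 1" using that abs_zmult_eq_1 by (metis, metis mult.commute)
    then have pm: "p = 1 \<or> p = -1" "s = 1 \<or> s = -1" by auto
    have "tri 1 (\<i> - 1) \<in> farey_triangles"
      using farey_triangles.base by (simp add: tri_base)
    with tri_shift_iff[of 1 "\<i> - 1" 1] have 1: "tri 1 \<i> \<in> farey_triangles"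
      by (simp add: det2_eq)
    then have 2: "tri 1 (- \<i>) \<in> farey_triangles"
      using tri_neg_mem by (simp add: det2_eq)
    have "tri (Complex p 0) (Complex 0 s) \<in> farey_triangles"
    proof -
      have "Complex 1 0 = 1" "Complex (-1) 0 = -1" "Complex 0 1 = \<i>" "Complex 0 (-1) = - \<i>"
        by (simp_all add: complex_eq_iff)
      with pm 1 2 tri_minus_minus[of 1 \<i>] tri_minus_minus[of 1 "- \<i>"] show ?thesis
        by auto
    qed
    with shift[of p s 0 r "- r * p"] that ps show ?thesis
      using pm by auto
  qed
  consider "q = 0" | "s = 0" | "q \<noteq> 0" "s \<noteq> 0" "\<bar>q\<bar> \<le> \<bar>s\<bar>" | "q \<noteq> 0" "s \<noteq> 0" "\<bar>s\<bar> \<le> \<bar>q\<bar>"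
    by linarith
  then show ?case
  proof cases
    case 1
    with real[of p s r] less.prems show ?thesis by simp
  next
    case 2
    with real[of r q p] less.prems show ?thesis
      by (simp add: tri_commute[of "Complex p q"] mult.commute)
  next
    case 3
    \<comment> \<open>With this sign,
      \<open>\<bar>s + k * q\<bar> = \<bar>s\<bar> - \<bar>q\<bar>\<close>.\<close>
    define k where "k = - sgn q * sgn s"
    have "tri (Complex p q) (Complex (r + k * p) (s + k * q)) \<in> farey_triangles"
    proof (rule less.hyps)
      show "nat (\<bar>q\<bar> + \<bar>s + k * q\<bar>) < nat (\<bar>q\<bar> + \<bar>s\<bar>)"
        using 3 by (auto simp: k_def sgn_if split: if_splits)
      show "\<bar>p * (s + k * q) - q * (r + k * p)\<bar> = 1"
        using less.prems by (simp add: algebra_simps)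
    qed
    with shift[of p s q r k] less.prems show ?thesis by simp
  next
    case 4
    define k where "k = - sgn q * sgn s"
    have m: "\<bar>r * q - s * p\<bar> = 1" using less.prems by (simp add: algebra_simps)
    have "tri (Complex r s) (Complex (p + k * r) (q + k * s)) \<in> farey_triangles"
    proof (rule less.hyps)
      show "nat (\<bar>s\<bar> + \<bar>q + k * s\<bar>) < nat (\<bar>q\<bar> + \<bar>s\<bar>)"
        using 4 by (auto simp: k_def sgn_if split: if_splits)
      show "\<bar>r * (q + k * s) - s * (p + k * r)\<bar> = 1"
        using m by (simp add: algebra_simps)
    qed
    with shift[of r q s p k] m show ?thesis
      by (simp add: tri_commute[of "Complex p q"])
  qed
qed

lemma tri_farey:
  assumes "u \<in> gint" "w \<in> gint" "\<bar>det2 u w\<bar> = 1"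
  shows "tri u w \<in> farey_triangles"
proof -
  from assms(1,2) obtain p q r s :: int
    where eq: "Re u = p" "Im u = q" "Re w = r" "Im w = s"
    by (auto simp: gint_def elim!: Ints_cases)
  then have "u = Complex p q" "w = Complex r s"
    by (simp_all add: complex_eq_iff)
  moreover have "\<bar>of_int (p * s - q * r) :: real\<bar> = 1"
    using assms(3) eq by (simp add: det2_eq)
  then have "\<bar>p * s - q * r\<bar> = 1"
    by (metis of_int_abs of_int_eq_1_iff)
  ultimately show ?thesis using tri_farey_int by simp
qed

section \<open>Edges and fans in terms of primitive vectors\<close>

definition prim :: "complex \<Rightarrow> bool" where
  "prim u \<longleftrightarrow> u \<in> gint \<and> (\<exists>w\<in>gint. det2 u w = 1)"

lemma primI: "u \<in> gint \<Longrightarrow> w \<in> gint \<Longrightarrow> \<bar>det2 u w\<bar> = 1 \<Longrightarrow> prim u"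
  unfolding prim_def
  by (cases "det2 u w = 1") (auto intro: bexI[of _ w] bexI[of _ "- w"])

lemma farey_edges_eq:
  "farey_edges = {{circ u, circ w} | u w. u \<in> gint \<and> w \<in> gint \<and> det2 u w = 1}"
proof (intro set_eqI iffI)
  fix e assume "e \<in> farey_edges"
  then obtain a b T where T: "T \<in> farey_triangles" and ab: "a \<in> T" "b \<in> T" "a \<noteq> b" "e = {a, b}"
    unfolding farey_edges_def by blast
  from farey_triangles_tri[OF T] obtain u w where
    uw0: "u \<in> gint" "w \<in> gint" "\<bar>det2 u w\<bar> = 1" and T: "T = tri u w" by blast
  obtain u' w' where uw: "u' \<in> gint" "w' \<in> gint" "\<bar>det2 u' w'\<bar> = 1" "a = circ u'" "b = circ w'"
    using ab unfolding T by (metis tri_side[OF uw0, of a b])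
  define w'' where "w'' = (if det2 u' w' = 1 then w' else - w')"
  have "det2 u' w'' = 1" "w'' \<in> gint" "circ w'' = circ w'"
    using uw by (auto simp: w''_def)
  with uw ab show "e \<in> {{circ u, circ w} | u w. u \<in> gint \<and> w \<in> gint \<and> det2 u w = 1}"
    by (intro CollectI exI[of _ u'] exI[of _ w'']) simp
next
  fix e assume "e \<in> {{circ u, circ w} | u w. u \<in> gint \<and> w \<in> gint \<and> det2 u w = 1}"
  then obtain u w where uw: "u \<in> gint" "w \<in> gint" "det2 u w = 1" "e = {circ u, circ w}" by blast
  then have "circ u \<noteq> circ w"
    using unimodular_nonzero[of u w] by (simp add: circ_eq_iff)
  moreover have "tri u w \<in> farey_triangles" using uw tri_farey by simp
  moreover have "circ u \<in> tri u w" "circ w \<in> tri u w" by (simp_all add: tri_def)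
  ultimately show "e \<in> farey_edges"
    unfolding farey_edges_def using uw by blast
qed

text \<open>\<open>prim\<close> expresses coprimality of the coordinates by a Bezout partner. By
  \<open>basis_expansion\<close>, \<open>u'\<close> is an integer multiple \<open>m\<close> of
  \<open>u\<close>, and the partner of \<open>u'\<close> yields \<open>m * n = 1\<close>.\<close>

lemma prim_circ_eq:
  assumes "prim u" "prim u'" "circ u = circ u'"
  shows "u' = u \<or> u' = - u"
proof -
  obtain w w' where w: "w \<in> gint" "w' \<in> gint" "det2 u w = 1" "det2 u' w' = 1" and g: "u \<in> gint" "u' \<in> gint"
    using assms unfolding prim_def by blast
  have nz: "u \<noteq> 0" "u' \<noteq> 0" using w by auto
  with assms have "det2 u u' = 0" by (simp add: circ_eq_iff)
  with basis_expansion[OF w(3), of u'] have u': "u' = of_real (det2 u' w) * u" by simp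
  from det2_gint[OF g(2) w(1)] obtain m :: int where m: "det2 u' w = m" by (elim Ints_cases)
  from det2_gint[OF g(1) w(2)] obtain n :: int where n: "det2 u w' = n" by (elim Ints_cases)
  have "det2 u' w' = of_int m * of_int n"
    using n by (subst u') (simp add: m)
  with w have "m * n = 1" by (metis of_int_eq_1_iff of_int_mult)
  then have "m = 1 \<or> m = - 1" by (simp add: zmult_eq_1_iff) auto
  with u' m show ?thesis by auto
qed

text \<open>A vector of determinant 1 or -1 with \<open>u\<close> has coefficient 1 or -1 at
  \<open>w\<close> in the basis \<open>u\<close>, \<open>w\<close>. As vectors count only up to
  sign, this leaves the \<open>w + k u\<close>.\<close>

lemma farey_fan_eq:
  assumes "u \<in> gint" "w \<in> gint" "det2 u w = 1"
  shows "farey_fan (circ u) = range (\<lambda>k. {circ u, circ (w + of_int k * u)})"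
proof (intro set_eqI iffI)
  fix e assume "e \<in> farey_fan (circ u)"
  then obtain x y where xy: "x \<in> gint" "y \<in> gint" "det2 x y = 1" "e = {circ x, circ y}" "circ u \<in> e"
    by (auto simp: farey_fan_def farey_edges_eq)
  have "\<exists>y\<in>gint. \<bar>det2 u y\<bar> = 1 \<and> e = {circ u, circ y}"
  proof -
    have "\<bar>det2 u w\<bar> = 1" "\<bar>det2 x y\<bar> = 1" "\<bar>det2 y x\<bar> = 1"
      using assms xy by (simp_all add: det2_swap[of y x])
    then have "prim u" "prim x" "prim y"
      using assms(1,2) xy(1,2) primI by blast+
    moreover have "circ x = circ u \<or> circ y = circ u" using xy(4,5) by auto
    ultimately have "u = x \<or> u = - x \<or> u = y \<or> u = - y"
      using prim_circ_eq[of x u] prim_circ_eq[of y u] by blast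
    then show ?thesis
    proof (elim disjE)
      assume "u = x" with xy show ?thesis by (intro bexI[of _ y]) auto
    next
      assume "u = - x" with xy show ?thesis by (intro bexI[of _ y]) auto
    next
      assume "u = y" with xy show ?thesis by (intro bexI[of _ x]) (auto simp: det2_swap[of y x])
    next
      assume "u = - y" with xy show ?thesis by (intro bexI[of _ x]) (auto simp: det2_swap[of y x])
    qed
  qed
  then obtain y where y: "y \<in> gint" "\<bar>det2 u y\<bar> = 1" "e = {circ u, circ y}" by blast
  from det2_gint[OF y(1) assms(2)] obtain n :: int where n: "det2 y w = n" by (elim Ints_cases)
  have "y = of_int n * u + of_real (det2 u y) * w"
    using basis_expansion[OF assms(3), of y] n by simp
  moreover have "det2 u y = 1 \<or> det2 u y = - 1" using y by auto
  ultimately have "y = w + of_int n * u \<or> y = - (w + of_int (- n) * u)"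
    by auto
  then obtain k :: int where "y = w + of_int k * u \<or> y = - (w + of_int k * u)" by blast
  then have "circ y = circ (w + of_int k * u)"
    by (elim disjE) (simp_all only: circ_minus)
  with y(3) show "e \<in> range (\<lambda>k. {circ u, circ (w + of_int k * u)})"
    by (intro image_eqI[of _ _ k]) simp_all
next
  fix e assume "e \<in> range (\<lambda>k. {circ u, circ (w + of_int k * u)})"
  then obtain k where "e = {circ u, circ (w + of_int k * u)}" by auto
  moreover have "det2 u (w + of_int k * u) = 1" "w + of_int k * u \<in> gint"
    using assms by simp_all
  ultimately show "e \<in> farey_fan (circ u)"
    using assms unfolding farey_fan_def farey_edges_eq by blast
qed

section \<open>Quadrilaterals and shears\<close>

lemma ccw_distinct: "ccw a b c \<Longrightarrow> a \<noteq> b \<and> b \<noteq> c \<and> a \<noteq> c"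
  by (auto simp: ccw_def algebra_simps)

text \<open>The vectors of the two given vertices are determined up to sign, so their sum is, up to
  sign, \<open>w + u\<close> or \<open>w - u\<close>. An edge thus lies in at most two
  triangles.\<close>

lemma farey_third_vertex:
  assumes uw: "u \<in> gint" "w \<in> gint" "det2 u w = 1"
    and T: "{circ u, circ w, z} \<in> farey_triangles" and z: "z \<noteq> circ u" "z \<noteq> circ w"
  shows "z = circ (w + u) \<or> z = circ (w - u)"
proof -
  from farey_triangles_tri[OF T] obtain x y where
    xy: "x \<in> gint" "y \<in> gint" "\<bar>det2 x y\<bar> = 1" and T: "{circ u, circ w, z} = tri x y" by blast
  have ne: "circ u \<noteq> circ w"
    using uw unimodular_nonzero[of u w] by (simp add: circ_eq_iff)
  have mem: "circ u \<in> tri x y" "circ w \<in> tri x y" using T by auto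
  obtain u' w' where u'w': "u' \<in> gint" "w' \<in> gint" "\<bar>det2 u' w'\<bar> = 1"
    "circ u = circ u'" "circ w = circ w'" "tri x y = tri u' w'"
    by (rule tri_side[OF xy mem ne])
  have "\<bar>det2 u w\<bar> = 1" "\<bar>det2 w u\<bar> = 1" "\<bar>det2 w' u'\<bar> = 1"
    using uw u'w' by (simp_all add: det2_swap[of w u] det2_swap[of w' u'])
  then have "prim u" "prim w" "prim u'" "prim w'"
    using uw(1,2) u'w'(1-3) primI by blast+
  then have "u' = u \<or> u' = - u" "w' = w \<or> w' = - w"
    using u'w' prim_circ_eq by blast+
  moreover have "z = circ (u' + w')"
    using T u'w' z ne by (auto simp: tri_def)
  ultimately show ?thesis
    using circ_minus[of "w + u"] circ_minus[of "w - u"] by (auto simp: add.commute)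
qed

lemma farey_quad_standard:
  assumes uw: "u \<in> gint" "w \<in> gint" "det2 u w = 1"
  shows "farey_quad {circ u, circ w} (circ u) (circ (w - u)) (circ w) (circ (w + u))"
proof -
  note nz = unimodular_nonzero[of u w]
  have "tri u (- w) \<in> farey_triangles" "tri u w \<in> farey_triangles"
    using uw by (simp_all add: tri_farey)
  moreover have "tri u (- w) = {circ u, circ (w - u), circ w}"
    using circ_minus[of "w - u"] by (auto simp: tri_def)
  moreover have "tri u w = {circ u, circ w, circ (w + u)}"
    by (auto simp: tri_def add.commute)
  moreover have "ccw (circ u) (circ (w - u)) (circ w)" "ccw (circ u) (circ w) (circ (w + u))"
    using nz uw by (subst ccw_circ; force simp: det2_swap[of w u] add.commute)+
  ultimately show ?thesis by (simp add: farey_quad_def)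
qed

text \<open>The orientation rejects one of the two candidates from \<open>farey_third_vertex\<close>
  on each side of the edge.\<close>

lemma farey_quad_unique:
  assumes uw: "u \<in> gint" "w \<in> gint" "det2 u w = 1"
    and q: "farey_quad e (circ u) b (circ w) d"
  shows "b = circ (w - u)" "d = circ (w + u)"
proof -
  note nz = unimodular_nonzero[of u w]
  from q have T: "{circ u, circ w, b} \<in> farey_triangles" "{circ u, circ w, d} \<in> farey_triangles"
    and cc: "ccw (circ u) b (circ w)" "ccw (circ u) (circ w) d"
    by (simp_all add: farey_quad_def insert_commute)
  have "\<not> ccw (circ u) (circ (w + u)) (circ w)" "\<not> ccw (circ u) (circ w) (circ (w - u))"
    using nz uw by (subst ccw_circ; force simp: det2_swap[of w u] add.commute)+
  with farey_third_vertex[OF uw T(1)] farey_third_vertex[OF uw T(2)] cc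
  show "b = circ (w - u)" "d = circ (w + u)"
    by (auto dest: ccw_distinct)
qed

lemma cr_rotate: "cr c b a d = cr a d c b"
proof -
  have *: "(a - b) * (d - c) = (c - d) * (b - a)" by (simp add: algebra_simps)
  show ?thesis unfolding cr_def * by (simp only: mult.commute)
qed

lemma shear_circ:
  assumes uw: "u \<in> gint" "w \<in> gint" "det2 u w = 1"
  shows "shear h {circ u, circ w} =
    ln (Re (cr (h (circ u)) (h (circ (w - u))) (h (circ w)) (h (circ (w + u)))))"
  unfolding shear_def
proof (rule the_equality)
  show "\<exists>a b c d. farey_quad {circ u, circ w} a b c d \<and>
      ln (Re (cr (h (circ u)) (h (circ (w - u))) (h (circ w)) (h (circ (w + u))))) =
      ln (Re (cr (h a) (h b) (h c) (h d)))"
    using farey_quad_standard[OF uw] by blast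
next
  fix s assume "\<exists>a b c d. farey_quad {circ u, circ w} a b c d \<and> s = ln (Re (cr (h a) (h b) (h c) (h d)))"
  then obtain a b c d where q: "farey_quad {circ u, circ w} a b c d"
    and s: "s = ln (Re (cr (h a) (h b) (h c) (h d)))" by blast
  from q have "{circ u, circ w} = {a, c}" by (simp add: farey_quad_def)
  then consider "a = circ u" "c = circ w" | "a = circ w" "c = circ u"
    by (auto simp: doubleton_eq_iff)
  then show "s = ln (Re (cr (h (circ u)) (h (circ (w - u))) (h (circ w)) (h (circ (w + u)))))"
  proof cases
    case 1
    with farey_quad_unique[OF uw] q s show ?thesis by blast
  next
    case 2
    \<comment> \<open>The labeling that starts at the other endpoint belongs to the basis
      \<open>w\<close>, \<open>- u\<close>. It exchanges \<open>a\<close> with \<open>c\<close> and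
      \<open>b\<close> with \<open>d\<close>, which preserves the cross ratio.\<close>
    have wu: "w \<in> gint" "- u \<in> gint" "det2 w (- u) = 1"
      using uw by (simp_all add: det2_swap[of w u])
    have "farey_quad {circ u, circ w} (circ w) b (circ (- u)) d"
      using q 2 by simp
    from farey_quad_unique[OF wu this] have "b = circ (w + u)" "d = circ (w - u)"
      using circ_minus[of "w + u"] by (simp_all add: add.commute)
    with 2 s cr_rotate show ?thesis by simp
  qed
qed

section \<open>The Cayley transform\<close>

lemma cayley_circ: "Im c \<noteq> 0 \<Longrightarrow> cayley (circ c) = of_real (Re c / Im c)"
proof -
  assume "Im c \<noteq> 0"
  then have "c \<noteq> 0" by auto
  then have "circ c + 1 = (c + cnj c) / c" "circ c - 1 = - ((c - cnj c) / c)"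
    by (simp_all add: circ_def add_divide_distrib diff_divide_distrib)
  then have "circ c + 1 = of_real (2 * Re c) / c" "circ c - 1 = - (of_real (2 * Im c) * \<i> / c)"
    unfolding complex_add_cnj complex_diff_cnj .
  with \<open>c \<noteq> 0\<close> \<open>Im c \<noteq> 0\<close> show ?thesis by (simp add: cayley_def)
qed

lemma Im_cayley: "z \<noteq> 1 \<Longrightarrow> Im (cayley z) = (1 - (cmod z)\<^sup>2) / (cmod (z - 1))\<^sup>2"
proof -
  assume "z \<noteq> 1"
  have "cayley z = - \<i> * ((z + 1) * cnj (z - 1)) / of_real ((cmod (z - 1))\<^sup>2)"
    using \<open>z \<noteq> 1\<close> unfolding cayley_def complex_div_cnj[of "z + 1"] by simp
  also have "Im \<dots> = Im (- \<i> * ((z + 1) * cnj (z - 1))) / (cmod (z - 1))\<^sup>2"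
    by (rule Im_divide_of_real)
  also have "Im (- \<i> * ((z + 1) * cnj (z - 1))) = 1 - (cmod z)\<^sup>2"
    by (simp add: cmod_power2[unfolded power2_eq_square] algebra_simps power2_eq_square)
  finally show ?thesis .
qed

lemma cayley_cayley_inv: "w \<noteq> - \<i> \<Longrightarrow> cayley (cayley_inv w) = w"
proof -
  assume "w \<noteq> - \<i>"
  then have "w + \<i> \<noteq> 0" by (metis add_eq_0_iff2)
  then have "cayley_inv w + 1 = 2 * w / (w + \<i>)" "cayley_inv w - 1 = - (2 * \<i>) / (w + \<i>)"
    by (simp_all add: cayley_inv_def divide_add_eq_iff divide_diff_eq_iff)
  with \<open>w + \<i> \<noteq> 0\<close> show ?thesis by (simp add: cayley_def)
qed

lemma cayley_inv_cayley: "z \<noteq> 1 \<Longrightarrow> cayley_inv (cayley z) = z"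
proof -
  assume "z \<noteq> 1"
  then have "cayley z - \<i> = - 2 * \<i> * z / (z - 1)" "cayley z + \<i> = - 2 * \<i> / (z - 1)"
    by (simp_all add: cayley_def field_simps)
  with \<open>z \<noteq> 1\<close> show ?thesis by (simp add: cayley_inv_def)
qed

lemma cayley_inv_eq_1: "cayley_inv w \<noteq> 1"
proof
  assume "cayley_inv w = 1"
  then have "w - \<i> = w + \<i>" by (simp add: cayley_inv_def divide_eq_1_iff)
  then show False by (simp add: complex_eq_iff)
qed

lemma cayley_inv_in_ball: "Im w > 0 \<Longrightarrow> cayley_inv w \<in> ball 0 1"
proof -
  assume "Im w > 0"
  then have "w \<noteq> - \<i>" by auto
  with Im_cayley[OF cayley_inv_eq_1[of w]] \<open>Im w > 0\<close> have "1 - (cmod (cayley_inv w))\<^sup>2 > 0"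
    using cayley_inv_eq_1[of w] by (simp add: cayley_cayley_inv zero_less_divide_iff)
  then show ?thesis by (simp add: power2_less_1_iff abs_square_less_1)
qed

lemma Im_cayley_pos: "z \<in> ball 0 1 \<Longrightarrow> Im (cayley z) > 0"
proof -
  assume "z \<in> ball 0 1"
  then have "cmod z < 1" by simp
  then have "z \<noteq> 1" "(cmod z)\<^sup>2 < 1" by (auto simp: abs_square_less_1)
  then show ?thesis by (simp add: Im_cayley)
qed

lemma cayley_image_ball: "cayley ` ball 0 1 = {z. Im z > 0}"
proof (intro set_eqI iffI)
  fix w assume "w \<in> {z. Im z > 0}"
  then have "w \<noteq> - \<i>" "cayley_inv w \<in> ball 0 1"
    using cayley_inv_in_ball[of w] by auto
  then have "w = cayley (cayley_inv w)" "cayley_inv w \<in> ball 0 1"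
    by (simp_all add: cayley_cayley_inv)
  then show "w \<in> cayley ` ball 0 1" by blast
qed (auto simp: Im_cayley_pos simp del: mem_ball)

section \<open>The indexing of the fans\<close>

lemma moebius_to_H_cayley:
  assumes "cmod v = 1"
  shows "moebius_to_H v (\<lambda>z. cayley (z / v))"
proof -
  have v: "v \<noteq> 0" using assms by auto
  have "(\<lambda>z. cayley (z / v)) = (\<lambda>z. (- \<i> * z + - \<i> * v) / (1 * z + - v))"
  proof
    fix z
    show "cayley (z / v) = (- \<i> * z + - \<i> * v) / (1 * z + - v)"
      using v by (cases "z = v") (simp_all add: cayley_def divide_simps, simp add: algebra_simps)
  qed
  moreover have "(\<lambda>z. z / v) ` ball 0 1 = ball 0 1"
  proof (intro set_eqI iffI)
    fix y assume "y \<in> ball (0::complex) 1"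
    with assms v show "y \<in> (\<lambda>z. z / v) ` ball 0 1"
      by (intro image_eqI[of _ _ "y * v"]) (auto simp: norm_mult)
  qed (use assms in \<open>auto simp: norm_divide\<close>)
  then have "(\<lambda>z. cayley (z / v)) ` ball 0 1 = {z. Im z > 0}"
    using cayley_image_ball by (metis image_image)
  ultimately show ?thesis
    unfolding moebius_to_H_def using v
    by (intro exI[of _ "- \<i>"] exI[of _ "- \<i> * v"] exI[of _ 1] exI[of _ "- v"]) simp
qed

text \<open>Two maps of the disk onto the half-plane with the same pole differ by an automorphism of
  the half-plane that fixes infinity. This controls the unspecified map in
  \<open>fan_indexing\<close>.\<close>

lemma moebius_to_H_affine:
  assumes "cmod v = 1" "moebius_to_H v M"
  obtains P and Q :: real where "Q > 0" "\<And>z. z \<noteq> v \<Longrightarrow> M z = P + of_real Q * cayley (z / v)"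
proof -
  from assms(2) obtain A B C D where nd: "A * D - B * C \<noteq> 0"
    and M: "M = (\<lambda>z. (A * z + B) / (C * z + D))" and pole: "C * v + D = 0"
    and im: "M ` ball 0 1 = {z. Im z > 0}"
    unfolding moebius_to_H_def by blast
  have v: "v \<noteq> 0" using assms by auto
  have D: "D = - C * v" using pole by (simp add: eq_neg_iff_add_eq_0 add.commute)
  have C: "C \<noteq> 0" using nd D by auto
  \<comment> \<open>Up to the factor \<open>2 * v\<close> this is the residue of \<open>M\<close> at
    \<open>v\<close>; \<open>eq\<close> below is the partial fraction decomposition.\<close>
  define R where "R = (A * v + B) / (2 * v * C)"
  define P where "P = A / C - R"
  define Q where "Q = \<i> * R"
  have "A * D - B * C = - C * (A * v + B)" by (simp add: D algebra_simps)
  then have "A * v + B \<noteq> 0" using nd by auto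
  then have Q0: "Q \<noteq> 0" using v C by (simp add: Q_def R_def)
  have eq: "M z = P + Q * cayley (z / v)" if "z \<noteq> v" for z
  proof -
    have zv: "z - v \<noteq> 0" using that by simp
    have "cayley (z / v) = - \<i> * ((z + v) / (z - v))"
      using v zv by (simp add: cayley_def divide_simps)
    then have "P + Q * cayley (z / v) = A / C + R * ((z + v) / (z - v) - 1)"
      by (simp add: P_def Q_def algebra_simps)
    also have "(z + v) / (z - v) - 1 = 2 * v / (z - v)"
      using zv by (simp add: divide_diff_eq_iff)
    also have "R * (2 * v / (z - v)) = (A * v + B) / (C * (z - v))"
      using v by (simp add: R_def)
    also have "A / C + \<dots> = (A * (z - v) + (A * v + B)) / (C * (z - v))"
      using C zv by (simp add: add_divide_distrib)
    also have "\<dots> = M z" by (simp add: M D algebra_simps)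
    finally show ?thesis ..
  qed
  have pos: "Im P + Re Q * Im w + Im Q * Re w > 0" if "Im w > 0" for w
  proof -
    have ball: "v * cayley_inv w \<in> ball 0 1"
      using cayley_inv_in_ball[OF that] assms by (simp add: norm_mult)
    then have "v * cayley_inv w \<noteq> v" using assms by auto
    moreover have "w \<noteq> - \<i>" using that by auto
    ultimately have "M (v * cayley_inv w) = P + Q * w"
      using v eq[of "v * cayley_inv w"] by (simp add: cayley_cayley_inv)
    moreover have "Im (M (v * cayley_inv w)) > 0" using ball im by blast
    ultimately show ?thesis by (simp add: algebra_simps)
  qed
  have ImQ: "Im Q = 0"
  proof (rule ccontr)
    assume "Im Q \<noteq> 0"
    \<comment> \<open>At this point of the half-plane the expression in \<open>pos\<close>
      vanishes.\<close>
    with pos[of "Complex (- (Im P + Re Q) / Im Q) 1"] show False by simp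
  qed
  have "Re Q \<ge> 0"
  proof (rule ccontr)
    assume "\<not> Re Q \<ge> 0"
    \<comment> \<open>High enough on the imaginary axis, a negative \<open>Re Q\<close> outweighs
      \<open>Im P\<close>.\<close>
    then have "Re Q * (\<bar>Im P\<bar> / (- Re Q) + 1) = - \<bar>Im P\<bar> + Re Q"
      by (simp add: field_simps)
    with \<open>\<not> Re Q \<ge> 0\<close> have "Im P + Re Q * (\<bar>Im P\<bar> / (- Re Q) + 1) < 0"
      by linarith
    moreover have "\<bar>Im P\<bar> / (- Re Q) + 1 > 0"
      using \<open>\<not> Re Q \<ge> 0\<close> by (intro add_nonneg_pos divide_nonneg_nonneg) auto
    ultimately show False
      using pos[of "Complex 0 (\<bar>Im P\<bar> / (- Re Q) + 1)"] by simp
  qed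
  with Q0 ImQ have "Re Q > 0" "Q = of_real (Re Q)" by (auto simp: complex_eq_iff)
  then show thesis using eq that by metis
qed

text \<open>Division by \<open>circ u\<close> is multiplication of vectors by \<open>cnj u\<close>,
  which moves \<open>u\<close> to the real axis and so to infinity. The neighbours become equally
  spaced.\<close>

lemma cayley_neighbour:
  assumes "det2 u w = 1"
  shows "cayley (circ (w + of_int k * u) / circ u) = of_real (Re (cnj u * w) + of_int k * (cmod u)\<^sup>2)"
proof -
  have u: "u \<noteq> 0" using assms by auto
  let ?y = "w + of_int k * u"
  have "circ ?y / circ u = circ (cnj u * ?y)"
    using u by (simp add: circ_def mult_ac)
  moreover have "Im (cnj u * ?y) = 1"
    unfolding det2_def[symmetric] using assms by simp
  moreover have "Re (cnj u * ?y) = Re (cnj u * w) + of_int k * (cmod u)\<^sup>2"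
    by (simp add: cmod_power2[unfolded power2_eq_square] algebra_simps power2_eq_square)
  ultimately show ?thesis by (simp add: cayley_circ[of "cnj u * ?y"])
qed

lemma neighbour_inj:
  assumes "det2 u w = 1" "circ (w + of_int k * u) = circ (w + of_int l * u)"
  shows "k = l"
proof -
  have "det2 u (w + of_int j * u) = 1" for j using assms by simp
  then have nz: "w + of_int j * u \<noteq> 0" for j
    using unimodular_nonzero(2)[of u "w + of_int j * u"] by simp
  have "det2 (w + of_int k * u) (w + of_int l * u) = 0"
    using circ_eq_iff[OF nz nz] assms(2) by blast
  then show ?thesis using assms(1) by (simp add: det2_swap[of w u])
qed

lemma neighbour_ne:
  assumes "det2 u w = 1"
  shows "circ (w + of_int k * u) \<noteq> circ u"
proof -
  have "det2 u (w + of_int k * u) = 1" using assms by simp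
  with unimodular_nonzero[of u "w + of_int k * u"] show ?thesis
    by (simp add: circ_eq_iff det2_swap[of _ u] del: det2_simps)
qed

lemma fan_indexing_ex:
  assumes uw: "u \<in> gint" "w \<in> gint" "det2 u w = 1"
  shows "fan_indexing (circ u) (\<lambda>k. {circ u, circ (w + of_int k * u)})"
proof -
  have u: "u \<noteq> 0" using uw by auto
  have "inj (\<lambda>k. {circ u, circ (w + of_int k * u)})"
    using neighbour_inj[OF uw(3)] by (intro injI) (auto simp: doubleton_eq_iff)
  then have "bij_betw (\<lambda>k. {circ u, circ (w + of_int k * u)}) UNIV (farey_fan (circ u))"
    unfolding farey_fan_eq[OF uw] by (rule inj_on_imp_bij_betw)
  moreover have "moebius_to_H (circ u) (\<lambda>z. cayley (z / circ u))"
    using u by (simp add: moebius_to_H_cayley)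
  moreover have "(cmod u)\<^sup>2 > 0" using u by simp
  ultimately show ?thesis
    unfolding fan_indexing_def using cayley_neighbour[OF uw(3)]
    by (intro conjI exI[of _ "\<lambda>z. cayley (z / circ u)"] exI[of _ "Re (cnj u * w)"]
        exI[of _ "(cmod u)\<^sup>2"]) auto
qed

text \<open>\<open>fan\<close> is an arbitrary choice among the indexings. Comparing coordinates
  shows that the index \<open>k n\<close> in the explicit fan is affine in \<open>n\<close> with
  positive integer slope; since every edge of the fan occurs, the slope is 1.\<close>

lemma fan_shift:
  assumes uw: "u \<in> gint" "w \<in> gint" "det2 u w = 1"
  obtains m where "\<And>n. fan (circ u) n = {circ u, circ (w + of_int (m + n) * u)}"
proof -
  have u: "u \<noteq> 0" using uw by auto
  let ?v = "circ u" and ?x = "\<lambda>k. circ (w + of_int k * u)"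
  have "fan_indexing ?v (fan ?v)"
    unfolding fan_def by (rule someI[of "fan_indexing ?v"]) (rule fan_indexing_ex[OF uw])
  then obtain M x \<delta> where bij: "bij_betw (fan ?v) UNIV (farey_fan ?v)"
    and M: "moebius_to_H ?v M" and \<delta>: "\<delta> > 0"
    and Mf: "\<And>n. \<exists>y. fan ?v n = {?v, y} \<and> M y = of_real (x + of_int n * \<delta>)"
    unfolding fan_indexing_def by blast
  obtain P Q where Q: "Q > 0" and PQ: "\<And>z. z \<noteq> ?v \<Longrightarrow> M z = P + of_real Q * cayley (z / ?v)"
    by (rule moebius_to_H_affine[OF norm_circ[OF u] M]) (rule that)
  have "\<forall>n. \<exists>k. fan ?v n = {?v, ?x k}"
    using bij unfolding bij_betw_def farey_fan_eq[OF uw] by blast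
  then obtain k where k: "\<And>n. fan ?v n = {?v, ?x (k n)}" by metis
  have lin: "Re P + Q * (Re (cnj u * w) + of_int (k n) * (cmod u)\<^sup>2) = x + of_int n * \<delta>" for n
  proof -
    obtain y where y: "fan ?v n = {?v, y}" "M y = of_real (x + of_int n * \<delta>)" using Mf by blast
    then have "y = ?x (k n)"
      using k[of n] neighbour_ne[OF uw(3), of "k n"] by (auto simp: doubleton_eq_iff)
    with y PQ neighbour_ne[OF uw(3), of "k n"] have
      "P + of_real Q * cayley (?x (k n) / ?v) = of_real (x + of_int n * \<delta>)" by metis
    then show ?thesis
      unfolding cayley_neighbour[OF uw(3)] by (simp add: complex_eq_iff)
  qed
  define r where "r = \<delta> / (Q * (cmod u)\<^sup>2)"
  have kr: "of_int (k n) = of_int (k 0) + of_int n * r" for n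
  proof -
    have "Q * (cmod u)\<^sup>2 * (of_int (k n) - of_int (k 0)) = of_int n * \<delta>"
      using lin[of n] lin[of 0] by (simp add: algebra_simps)
    with Q u show ?thesis by (simp add: r_def field_simps)
  qed
  have "r > 0" using Q u \<delta> by (simp add: r_def)
  define d where "d = k 1 - k 0"
  have rd: "r = of_int d" using kr[of 1] by (simp add: d_def)
  with \<open>r > 0\<close> have "d > 0" by simp
  have kd: "k n = k 0 + n * d" for n
    using kr[of n] unfolding rd by (metis of_int_add of_int_eq_iff of_int_mult)
  have "{?v, ?x (k 0 + 1)} \<in> range (fan ?v)"
    using bij unfolding bij_betw_def farey_fan_eq[OF uw] by blast
  then obtain n where "{?v, ?x (k 0 + 1)} = {?v, ?x (k n)}" using k by auto
  then have "?x (k 0 + 1) = ?x (k n)" by (auto simp: doubleton_eq_iff)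
  then have "k n = k 0 + 1" using neighbour_inj[OF uw(3)] by metis
  with kd[of n] have "n * d = 1" by simp
  with \<open>d > 0\<close> have "d = 1" by (simp add: zmult_eq_1_iff)
  have "fan ?v n = {?v, ?x (k 0 + n)}" for n
    using k[of n] kd[of n] \<open>d = 1\<close> by simp
  then show thesis by (rule that)
qed

section \<open>Linear growth from converging increments\<close>

text \<open>The shear of edge \<open>n\<close> will be \<open>G n - G (n - 1)\<close>. Hence the
  edges strictly after \<open>j\<close> leave the term \<open>G j\<close>, while those strictly
  before \<open>j\<close> leave \<open>G (j - 1)\<close>.\<close>

lemma telescoping_at_top:
  fixes G :: "int \<Rightarrow> real"
  assumes "(G \<longlongrightarrow> L) at_top"
  shows "(\<lambda>k. G (j + int (Suc k)) - G (j + int (Suc k) - 1)) sums (L - G j)"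
proof -
  have "filterlim (\<lambda>k. j + int k) at_top sequentially"
    unfolding filterlim_at_top eventually_sequentially
  proof
    fix Z show "\<exists>N. \<forall>n\<ge>N. Z \<le> j + int n"
      by (rule exI[of _ "nat (Z - j)"]) auto
  qed
  then have "(\<lambda>k. G (j + int k)) \<longlonglongrightarrow> L"
    using assms by (rule filterlim_compose[rotated])
  from telescope_sums[OF this] show ?thesis by (simp add: algebra_simps)
qed

lemma filterlim_uminus_int_at_bot: "filterlim (uminus :: int \<Rightarrow> int) at_bot at_top"
  unfolding filterlim_at_bot eventually_at_top_linorder
proof
  fix Z :: int show "\<exists>N. \<forall>n\<ge>N. - n \<le> Z" by (rule exI[of _ "- Z"]) auto
qed

lemma telescoping_at_bot:
  fixes G :: "int \<Rightarrow> real"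
  assumes "(G \<longlongrightarrow> L) at_bot"
  shows "(\<lambda>k. G (j - int (Suc k)) - G (j - int (Suc k) - 1)) sums (G (j - 1) - L)"
proof -
  have "((\<lambda>k. - G (- k)) \<longlongrightarrow> - L) at_top"
    by (intro tendsto_minus filterlim_compose[OF assms filterlim_uminus_int_at_bot])
  from telescoping_at_top[OF this, of "1 - j"] show ?thesis
    by (simp add: algebra_simps)
qed

lemma tendsto_at_top_int:
  fixes G :: "int \<Rightarrow> real"
  assumes "(\<lambda>n. G (int n)) \<longlonglongrightarrow> L"
  shows "(G \<longlongrightarrow> L) at_top"
proof (rule Lim_transform_eventually)
  show "((\<lambda>k. G (int (nat k))) \<longlongrightarrow> L) at_top"
    using assms filterlim_nat_sequentially by (rule filterlim_compose)
  show "\<forall>\<^sub>F k in at_top. G (int (nat k)) = G k"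
    using eventually_ge_at_top[of 0] by eventually_elim simp
qed

text \<open>The two sums are \<open>G (- 1)\<close> minus the limit at the bottom, and the limit at
  the top minus \<open>G (- 1)\<close>. Their total is the difference of the limits, so its
  vanishing makes them equal.\<close>

lemma two_sided_telescoping_limit:
  fixes G :: "int \<Rightarrow> real"
  assumes "summable (\<lambda>k. G (- int (Suc k)) - G (- int (Suc k) - 1))"
    and "summable (\<lambda>k. G (int k) - G (int k - 1))"
    and "(\<Sum>k. G (- int (Suc k)) - G (- int (Suc k) - 1)) + (\<Sum>k. G (int k) - G (int k - 1)) = 0"
  obtains L where "(G \<longlongrightarrow> L) at_top" "(G \<longlongrightarrow> L) at_bot"
proof -
  let ?s = "\<Sum>k. G (int k) - G (int k - 1)"
  have sum_up: "(\<Sum>k<n. G (int k) - G (int k - 1)) = G (int n - 1) - G (- 1)" for n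
    by (induction n) simp_all
  have sum_down: "(\<Sum>k<n. G (- int (Suc k)) - G (- int (Suc k) - 1)) = G (- 1) - G (- int (Suc n))" for n
  proof (induction n)
    case (Suc n)
    have "- int (Suc (Suc n)) = - int (Suc n) - 1" by simp
    with Suc show ?case by (simp only: sum.lessThan_Suc)
  qed simp
  have "(\<lambda>n. G (int n - 1) - G (- 1)) \<longlonglongrightarrow> ?s"
    using summable_LIMSEQ[OF assms(2)] unfolding sum_up .
  then have "(\<lambda>n. G (int n - 1) - G (- 1) + G (- 1)) \<longlonglongrightarrow> ?s + G (- 1)"
    by (intro tendsto_intros)
  then have "(\<lambda>n. G (int (Suc n) - 1)) \<longlonglongrightarrow> ?s + G (- 1)"
    by (intro LIMSEQ_Suc) simp
  then have up: "(G \<longlongrightarrow> ?s + G (- 1)) at_top"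
    by (intro tendsto_at_top_int) simp
  have neg: "(\<Sum>k. G (- int (Suc k)) - G (- int (Suc k) - 1)) = - ?s"
    using assms(3) by linarith
  have "(\<lambda>n. G (- 1) - G (- int (Suc n))) \<longlonglongrightarrow> - ?s"
    using summable_LIMSEQ[OF assms(1)] unfolding sum_down neg .
  then have "(\<lambda>n. G (- 1) - (G (- 1) - G (- int (Suc n)))) \<longlonglongrightarrow> G (- 1) - (- ?s)"
    by (intro tendsto_intros)
  then have "((\<lambda>k. G (- 1 - k)) \<longlongrightarrow> ?s + G (- 1)) at_top"
    by (intro tendsto_at_top_int) (simp add: add.commute)
  moreover have "filterlim (\<lambda>k::int. - 1 - k) at_top at_bot"
    unfolding filterlim_at_top eventually_at_bot_linorder
  proof
    fix Z :: int show "\<exists>N. \<forall>n\<le>N. Z \<le> - 1 - n" by (rule exI[of _ "- Z - 1"]) auto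
  qed
  ultimately have "((\<lambda>k. G (- 1 - (- 1 - k))) \<longlongrightarrow> ?s + G (- 1)) at_bot"
    by (rule filterlim_compose)
  then show thesis using that up by simp
qed

text \<open>From \<open>N\<close> on the increments are below \<open>e / 2\<close>; the fixed
  contribution \<open>\<bar>b N\<bar>\<close> is at most \<open>M\<close> times \<open>e / 2\<close>
  and so costs at most another \<open>e / 2\<close> on average.\<close>

lemma average_tendsto_zero:
  fixes b :: "nat \<Rightarrow> real"
  assumes "(\<lambda>n. b (Suc n) - b n) \<longlonglongrightarrow> 0"
  shows "(\<lambda>n. b n / real n) \<longlonglongrightarrow> 0"
proof (rule LIMSEQ_I)
  fix e :: real assume "e > 0"
  with assms obtain N where N: "\<And>n. n \<ge> N \<Longrightarrow> \<bar>b (Suc n) - b n\<bar> < e / 2"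
    using LIMSEQ_D[OF assms, of "e / 2"] by auto
  have bound: "\<bar>b (N + n)\<bar> \<le> \<bar>b N\<bar> + real n * (e / 2)" for n
  proof (induction n)
    case (Suc n)
    have "real (Suc n) * (e / 2) = real n * (e / 2) + e / 2" by (simp add: field_simps)
    with N[of "N + n"] Suc show ?case unfolding add_Suc_right by linarith
  qed simp
  obtain M :: nat where M: "\<bar>b N\<bar> < real M * (e / 2)"
    using reals_Archimedean3[of "e / 2"] \<open>e > 0\<close> by auto
  have "norm (b n / real n - 0) < e" if n: "n \<ge> Suc (N + M)" for n
  proof -
    have "\<bar>b n\<bar> \<le> \<bar>b N\<bar> + real (n - N) * (e / 2)"
      using bound[of "n - N"] n by simp
    also have "\<dots> < real M * (e / 2) + real (n - N) * (e / 2)" using M by simp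
    also have "\<dots> \<le> real n * (e / 2) + real n * (e / 2)"
      using n \<open>e > 0\<close> by (intro add_mono mult_right_mono) auto
    finally show ?thesis using n by (simp add: field_simps)
  qed
  then show "\<exists>no. \<forall>n\<ge>no. norm (b n / real n - 0) < e" by blast
qed

lemma stolz_cesaro:
  fixes a :: "nat \<Rightarrow> real"
  assumes "(\<lambda>n. a (Suc n) - a n) \<longlonglongrightarrow> D"
  shows "(\<lambda>n. a n / real n) \<longlonglongrightarrow> D"
proof -
  have "(\<lambda>n. (a (Suc n) - a n) - D) \<longlonglongrightarrow> D - D"
    using assms by (intro tendsto_intros)
  then have "(\<lambda>n. (a n - D * real n) / real n) \<longlonglongrightarrow> 0"
    by (intro average_tendsto_zero) (simp add: algebra_simps)
  then have "(\<lambda>n. (a n - D * real n) / real n + D) \<longlonglongrightarrow> 0 + D"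
    by (intro tendsto_intros)
  then have "(\<lambda>n. (a n - D * real n) / real n + D) \<longlonglongrightarrow> D"
    by (simp only: add_0)
  then show ?thesis
    by (rule Lim_transform_eventually[OF _ eventually_mono[OF eventually_gt_at_top[of 0]]])
      (simp add: field_simps)
qed

text \<open>Along the progression the claim is \<open>stolz_cesaro\<close>. A general
  \<open>t\<close> lies between the consecutive points with indices \<open>N t\<close> and
  \<open>Suc (N t)\<close>, and monotonicity sandwiches \<open>g t\<close>.\<close>

lemma linear_growth:
  fixes g :: "real \<Rightarrow> real"
  assumes mono: "\<And>x y. T \<le> x \<Longrightarrow> x \<le> y \<Longrightarrow> g x \<le> g y" and m: "m > 0"
    and lim: "(\<lambda>n. g (c + m * real (Suc n)) - g (c + m * real n)) \<longlonglongrightarrow> D"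
  shows "((\<lambda>t. g t / t) \<longlongrightarrow> D / m) at_top"
proof -
  define N where "N t = nat \<lfloor>(t - c) / m\<rfloor>" for t
  have avg: "(\<lambda>n. g (c + m * real n) / real n) \<longlonglongrightarrow> D"
    using lim by (rule stolz_cesaro)
  have N1: "\<forall>\<^sub>F t in at_top. c + m * real (N t) \<le> t \<and> t \<le> c + m * real (Suc (N t)) \<and>
      T \<le> c + m * real (N t) \<and> N t > 0 \<and> t > 0"
    using eventually_ge_at_top[of "max c (max (T + m) (c + m))"] eventually_gt_at_top[of 0]
  proof eventually_elim
    case (elim t)
    then have "(t - c) / m \<ge> 1" using m by (simp add: field_simps)
    then have N: "real (N t) = of_int \<lfloor>(t - c) / m\<rfloor>" "N t > 0"
      by (simp_all add: N_def)
    then have "real (N t) \<le> (t - c) / m" "(t - c) / m \<le> real (N t) + 1"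
      by linarith+
    then have "m * real (N t) \<le> t - c" "t - c \<le> m * (real (N t) + 1)"
      using m by (simp_all add: field_simps)
    with elim N m show ?case by (auto simp: algebra_simps)
  qed
  have Ntop: "filterlim N at_top at_top"
    unfolding N_def
    by (intro filterlim_compose[OF filterlim_nat_sequentially]
        filterlim_compose[OF filterlim_floor_sequentially]) (use m in real_asymp)
  have ratio: "((\<lambda>t. real (N t) / t) \<longlongrightarrow> inverse m) at_top"
  proof (rule tendsto_sandwich)
    show "((\<lambda>t. ((t - c) / m - 1) / t) \<longlongrightarrow> inverse m) at_top" "((\<lambda>t. ((t - c) / m) / t) \<longlongrightarrow> inverse m) at_top"
      using m by real_asymp+
    show "\<forall>\<^sub>F t in at_top. ((t - c) / m - 1) / t \<le> real (N t) / t"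
      using N1
    proof eventually_elim
      case (elim t)
      with m have "(t - c) / m - 1 \<le> real (N t)" by (simp add: field_simps)
      with elim show ?case by (intro divide_right_mono) auto
    qed
    show "\<forall>\<^sub>F t in at_top. real (N t) / t \<le> ((t - c) / m) / t"
      using N1 by eventually_elim (use m in \<open>auto simp: field_simps\<close>)
  qed
  have low: "((\<lambda>t. g (c + m * real (N t)) / real (N t) * (real (N t) / t)) \<longlongrightarrow> D * inverse m) at_top"
    by (intro tendsto_mult ratio filterlim_compose[OF avg Ntop])
  \<comment> \<open>The upper bound exceeds the lower one by a convergent increment divided by
    \<open>t\<close>.\<close>
  have "((\<lambda>t. (g (c + m * real (Suc (N t))) - g (c + m * real (N t))) * inverse t) \<longlongrightarrow> D * 0) at_top"
    by (intro tendsto_mult filterlim_compose[OF lim Ntop] tendsto_inverse_0_at_top filterlim_ident)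
  from tendsto_add[OF low this]
  have up: "((\<lambda>t. g (c + m * real (N t)) / real (N t) * (real (N t) / t) +
      (g (c + m * real (Suc (N t))) - g (c + m * real (N t))) * inverse t) \<longlongrightarrow> D / m) at_top"
    by (simp only: mult_zero_right add_0_right divide_inverse)
  from low have low: "((\<lambda>t. g (c + m * real (N t)) / real (N t) * (real (N t) / t)) \<longlongrightarrow> D / m) at_top"
    by (simp only: mult_zero_right add_0_right divide_inverse)
  show ?thesis
  proof (rule tendsto_sandwich[OF _ _ low up])
    show "\<forall>\<^sub>F t in at_top. g (c + m * real (N t)) / real (N t) * (real (N t) / t) \<le> g t / t"
      using N1
    proof eventually_elim
      case (elim t)
      then have "g (c + m * real (N t)) \<le> g t" by (intro mono) auto
      with elim show ?case by (simp add: divide_right_mono)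
    qed
    show "\<forall>\<^sub>F t in at_top. g t / t \<le> g (c + m * real (N t)) / real (N t) * (real (N t) / t) +
        (g (c + m * real (Suc (N t))) - g (c + m * real (N t))) * inverse t"
      using N1
    proof eventually_elim
      case (elim t)
      then have "g t \<le> g (c + m * real (Suc (N t)))" by (intro mono) auto
      then have "g t / t \<le> g (c + m * real (Suc (N t))) / t"
        using elim by (intro divide_right_mono) auto
      with elim show ?case by (simp add: field_simps)
    qed
  qed
qed

text \<open>The assumptions concern one half-line only: in the chart used at a finite vertex,
  \<open>t = 0\<close> corresponds to the point at infinity.\<close>

lemma linear_growth_log_at_top:
  fixes g :: "real \<Rightarrow> real" and G :: "int \<Rightarrow> real"
  assumes mono: "\<And>x y. 0 < x \<Longrightarrow> x < y \<Longrightarrow> g x < g y" and m: "m > 0"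
    and lim: "(G \<longlongrightarrow> L) at_top"
    and G: "\<And>k. c + m * of_int k > 0 \<Longrightarrow> G k = ln (g (c + m * of_int (k + 1)) - g (c + m * of_int k))"
  shows "((\<lambda>t. g t / t) \<longlongrightarrow> exp L / m) at_top"
proof (rule linear_growth[OF _ m])
  show "g x \<le> g y" if "1 \<le> x" "x \<le> y" for x y
    using mono[of x y] that by (cases "x = y") auto
  have "(\<lambda>n. exp (G (int n))) \<longlonglongrightarrow> exp L"
    by (intro tendsto_exp filterlim_compose[OF lim filterlim_int_sequentially])
  moreover have "filterlim (\<lambda>n::nat. c + m * real n) at_top sequentially"
    using m by real_asymp
  then have "\<forall>\<^sub>F n in sequentially. c + m * real n > 0"
    by (rule filterlim_at_top_dense[THEN iffD1, rule_format])
  then have "\<forall>\<^sub>F n in sequentially.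
      exp (G (int n)) = g (c + m * real (Suc n)) - g (c + m * real n)"
  proof eventually_elim
    case (elim n)
    then have "g (c + m * real n) < g (c + m * real (Suc n))"
      using m by (intro mono) (auto simp: algebra_simps)
    with G[of "int n"] elim show ?case by (simp add: add.commute)
  qed
  ultimately show "(\<lambda>n. g (c + m * real (Suc n)) - g (c + m * real n)) \<longlonglongrightarrow> exp L"
    by (rule Lim_transform_eventually)
qed

lemma linear_growth_log_at_bot:
  fixes g :: "real \<Rightarrow> real" and G :: "int \<Rightarrow> real"
  assumes mono: "\<And>x y. x < y \<Longrightarrow> y < 0 \<Longrightarrow> g x < g y" and m: "m > 0"
    and lim: "(G \<longlongrightarrow> L) at_bot"
    and G: "\<And>k. c + m * of_int (k + 1) < 0 \<Longrightarrow> G k = ln (g (c + m * of_int (k + 1)) - g (c + m * of_int k))"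
  shows "((\<lambda>t. g t / t) \<longlongrightarrow> exp L / m) at_bot"
proof -
  have "((\<lambda>t. - g (- t) / t) \<longlongrightarrow> exp L / m) at_top"
  \<comment> \<open>After the change of sign, the interval from \<open>c + m * k\<close> to
    \<open>c + m * (k + 1)\<close> has the left end \<open>- c - m + m * (- k)\<close>; hence the
    new origin.\<close>
  proof (rule linear_growth_log_at_top[where c = "- c - m" and G = "\<lambda>k. G (- k)"])
    show "((\<lambda>k. G (- k)) \<longlongrightarrow> L) at_top"
      by (rule filterlim_compose[OF lim filterlim_uminus_int_at_bot])
    fix k :: int assume "- c - m + m * of_int k > 0"
    with G[of "- k"] show "G (- k) = ln (- g (- (- c - m + m * of_int (k + 1))) - - g (- (- c - m + m * of_int k)))"
      by (simp add: algebra_simps)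
  qed (use mono m in auto)
  then show ?thesis
    by (simp add: filterlim_at_bot_mirror)
qed

text \<open>\<open>t = - 1 / x\<close> moves the point at infinity to \<open>0\<close>.\<close>

lemma quotient_at_zero:
  fixes g :: "real \<Rightarrow> real"
  assumes "((\<lambda>t. g t / t) \<longlongrightarrow> C) at_top" "((\<lambda>t. g t / t) \<longlongrightarrow> C) at_bot" "C \<noteq> 0"
  shows "((\<lambda>x. (- 1 / g (- 1 / x)) / x) \<longlongrightarrow> 1 / C) (at 0)"
proof -
  have eq: "inverse (g (- 1 / x) / (- 1 / x)) = (- 1 / g (- 1 / x)) / x" for x
    by (simp add: field_simps)
  have "filterlim (\<lambda>x::real. - 1 / x) at_bot (at_right 0)" by real_asymp
  with assms(2) have "((\<lambda>x. g (- 1 / x) / (- 1 / x)) \<longlongrightarrow> C) (at_right 0)"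
    by (rule filterlim_compose)
  moreover have "filterlim (\<lambda>x::real. - 1 / x) at_top (at_left 0)" by real_asymp
  with assms(1) have "((\<lambda>x. g (- 1 / x) / (- 1 / x)) \<longlongrightarrow> C) (at_left 0)"
    by (rule filterlim_compose)
  ultimately have "((\<lambda>x. inverse (g (- 1 / x) / (- 1 / x))) \<longlongrightarrow> inverse C) (at_right 0)"
    "((\<lambda>x. inverse (g (- 1 / x) / (- 1 / x))) \<longlongrightarrow> inverse C) (at_left 0)"
    using assms(3) tendsto_inverse by blast+
  then show ?thesis
    unfolding eq by (simp add: filterlim_split_at inverse_eq_divide)
qed

section \<open>Horocycles\<close>

text \<open>One equation for both cases of \<open>geodesic\<close>: the equation of the orthogonal
  circle multiplied by \<open>a + b\<close>. For \<open>a + b = 0\<close> it becomes that of the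
  diameter.\<close>

lemma geodesic_iff:
  assumes ab: "cmod a = 1" "cmod b = 1" "a \<noteq> b"
  shows "z \<in> geodesic a b \<longleftrightarrow> z \<in> ball 0 1 \<and> (1 + z * cnj z) * (a + b) = 2 * (z + a * b * cnj z)"
proof -
  have nz: "a \<noteq> 0" "b \<noteq> 0" using ab by auto
  have cn: "cnj a = 1 / a" "cnj b = 1 / b"
    using ab by (simp_all add: divide_conv_cnj)
  show ?thesis
  proof (cases "a + b = 0")
    case True
    then have b: "b = - a" by (simp add: eq_neg_iff_add_eq_0 add.commute)
    have "z \<in> geodesic a b \<longleftrightarrow> z \<in> ball 0 1 \<and> z = a * a * cnj z"
    proof
      assume "z \<in> geodesic a b"
      then obtain t where "z = of_real t * a" "- 1 < t" "t < 1"
        using True by (auto simp: geodesic_def)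
      then show "z \<in> ball 0 1 \<and> z = a * a * cnj z"
        using ab nz by (simp add: norm_mult cn)
    next
      assume z: "z \<in> ball 0 1 \<and> z = a * a * cnj z"
      then have "cnj (z / a) = z / a" using nz by (simp add: cn field_simps)
      then have "z / a = of_real (Re (z / a))"
        unfolding Reals_cnj_iff[symmetric] by simp
      then have za: "z = of_real (Re (z / a)) * a" using nz by (simp add: field_simps)
      moreover have "\<bar>Re (z / a)\<bar> < 1"
        using z ab abs_Re_le_cmod[of "z / a"] by (simp add: norm_divide)
      ultimately show "z \<in> geodesic a b"
        using True unfolding geodesic_def by auto
    qed
    then show ?thesis by (simp add: b)
  next
    case False
    define c where "c = orth_center a b"
    have c: "c * (a + b) = 2 * a * b" and cc: "cnj c * (a + b) = 2"
      and r: "(orth_radius a b)\<^sup>2 = (cmod c)\<^sup>2 - 1" "orth_radius a b \<ge> 0"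
      using orth_circle[OF ab(1,2) False] by (simp_all add: c_def)
    have "z \<in> sphere c (orth_radius a b) \<longleftrightarrow> (cmod (c - z))\<^sup>2 = (cmod c)\<^sup>2 - 1"
      using r by (metis dist_norm mem_sphere norm_ge_zero power2_eq_iff_nonneg)
    also have "\<dots> \<longleftrightarrow> (c - z) * cnj (c - z) = c * cnj c - 1"
      unfolding complex_norm_square[symmetric] by (metis of_real_1 of_real_diff of_real_eq_iff)
    also have "\<dots> \<longleftrightarrow> 1 + z * cnj z = z * cnj c + c * cnj z"
      by (auto simp: algebra_simps)
    also have "\<dots> \<longleftrightarrow> (1 + z * cnj z) * (a + b) = (z * cnj c + c * cnj z) * (a + b)"
      using False by simp
    also have "(z * cnj c + c * cnj z) * (a + b) = z * (cnj c * (a + b)) + (c * (a + b)) * cnj z"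
      by (simp only: ring_distribs mult_ac)
    also have "\<dots> = 2 * (z + a * b * cnj z)"
      unfolding c cc by simp
    finally show ?thesis using False by (auto simp: geodesic_def c_def)
  qed
qed

lemma cayley_Re_norm:
  assumes "z \<noteq> 1"
  shows "Re (cayley z) = - 2 * Im z / (cmod (z - 1))\<^sup>2"
    "(cmod (cayley z))\<^sup>2 = (cmod (z + 1))\<^sup>2 / (cmod (z - 1))\<^sup>2"
proof -
  have "cayley z = - \<i> * ((z + 1) * cnj (z - 1)) / of_real ((cmod (z - 1))\<^sup>2)"
    using assms unfolding cayley_def complex_div_cnj[of "z + 1"] by simp
  also have "Re \<dots> = Re (- \<i> * ((z + 1) * cnj (z - 1))) / (cmod (z - 1))\<^sup>2"
    by (rule Re_divide_of_real)
  also have "Re (- \<i> * ((z + 1) * cnj (z - 1))) = - 2 * Im z"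
    by (simp add: algebra_simps)
  finally show "Re (cayley z) = - 2 * Im z / (cmod (z - 1))\<^sup>2" .
  show "(cmod (cayley z))\<^sup>2 = (cmod (z + 1))\<^sup>2 / (cmod (z - 1))\<^sup>2"
    by (simp add: cayley_def norm_mult norm_divide power_divide)
qed

text \<open>The half-plane equation of the semicircle over \<open>Re U / Im U\<close> and
  \<open>Re W / Im W\<close>, with cleared denominators. It therefore includes vertical
  lines.\<close>

lemma geodesic_circ_iff:
  assumes "det2 U W \<noteq> 0"
  shows "z \<in> geodesic (circ U) (circ W) \<longleftrightarrow> z \<in> ball 0 1 \<and>
    Im U * Im W * (cmod (cayley z))\<^sup>2 - (Re U * Im W + Im U * Re W) * Re (cayley z) + Re U * Re W = 0"
proof -
  have nz: "U \<noteq> 0" "W \<noteq> 0" using assms by auto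
  then have ne: "circ U \<noteq> circ W" using assms by (simp add: circ_eq_iff)
  have "(1 + z * cnj z) * (circ U + circ W) = 2 * (z + circ U * circ W * cnj z) \<longleftrightarrow>
      Im U * Im W * (cmod (cayley z))\<^sup>2 - (Re U * Im W + Im U * Re W) * Re (cayley z) + Re U * Re W = 0"
    if z: "z \<in> ball 0 1"
  proof -
    have z1: "z \<noteq> 1" using z by auto
    then have pos: "(cmod (z - 1))\<^sup>2 > 0" by simp
    \<comment> \<open>The factor \<open>U * W\<close> makes both sides real, so that the complex
      equation is a single real one.\<close>
    have "(1 + z * cnj z) * (circ U + circ W) = 2 * (z + circ U * circ W * cnj z) \<longleftrightarrow>
        (1 + z * cnj z) * (circ U + circ W) * (U * W) = 2 * (z + circ U * circ W * cnj z) * (U * W)"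
      using nz by simp
    also have "(1 + z * cnj z) * (circ U + circ W) * (U * W) = (1 + z * cnj z) * (cnj U * W + cnj W * U)"
      using nz by (simp add: circ_def field_simps)
    also have "2 * (z + circ U * circ W * cnj z) * (U * W) = 2 * (z * U * W + cnj (z * U * W))"
      using nz by (simp add: circ_def field_simps)
    also have "(1 + z * cnj z) * (cnj U * W + cnj W * U)
        = of_real (2 * (1 + (cmod z)\<^sup>2) * (Re U * Re W + Im U * Im W))"
      by (simp add: complex_norm_square[symmetric] complex_eq_iff algebra_simps)
    also have "2 * (z * U * W + cnj (z * U * W)) = of_real (4 * Re (z * U * W))"
      unfolding complex_add_cnj by simp
    also have "of_real (2 * (1 + (cmod z)\<^sup>2) * (Re U * Re W + Im U * Im W))
        = (of_real (4 * Re (z * U * W)) :: complex) \<longleftrightarrow>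
      2 * (1 + (cmod z)\<^sup>2) * (Re U * Re W + Im U * Im W) = 4 * Re (z * U * W)"
      by (rule of_real_eq_iff)
    also have "\<dots> \<longleftrightarrow> Im U * Im W * (cmod (z + 1))\<^sup>2 + (Re U * Im W + Im U * Re W) * (2 * Im z)
        + Re U * Re W * (cmod (z - 1))\<^sup>2 = 0"
    proof -
      have *: "a = b \<longleftrightarrow> c = 0" if "a - b = 2 * c" for a b c :: real
        using that by auto
      show ?thesis
        by (rule *) (simp add: cmod_power2, simp add: power2_eq_square algebra_simps)
    qed
    also have "Im U * Im W * (cmod (z + 1))\<^sup>2 + (Re U * Im W + Im U * Re W) * (2 * Im z)
        + Re U * Re W * (cmod (z - 1))\<^sup>2 =
      (Im U * Im W * (cmod (cayley z))\<^sup>2 - (Re U * Im W + Im U * Re W) * Re (cayley z) + Re U * Re W)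
      * (cmod (z - 1))\<^sup>2"
      using pos unfolding cayley_Re_norm[OF z1] by (simp add: field_simps)
    finally show ?thesis using pos by simp
  qed
  then show ?thesis using geodesic_iff[of "circ U" "circ W" z] nz ne by auto
qed

text \<open>The Cayley map is an isometry onto the half-plane model: the factors from
  \<open>z - 1\<close> and \<open>w - 1\<close> cancel.\<close>

lemma hyp_dist_cayley:
  assumes "z \<in> ball 0 1" "w \<in> ball 0 1"
  shows "hyp_dist z w =
    arcosh (1 + (cmod (cayley z - cayley w))\<^sup>2 / (2 * Im (cayley z) * Im (cayley w)))"
proof -
  have 1: "z \<noteq> 1" "w \<noteq> 1" using assms by auto
  then have p: "cmod (z - 1) \<noteq> 0" "cmod (w - 1) \<noteq> 0" by simp_all
  have "cayley z - cayley w = 2 * \<i> * (z - w) / ((z - 1) * (w - 1))"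
    using 1 by (simp add: cayley_def divide_simps) (simp add: algebra_simps)
  then have "(cmod (cayley z - cayley w))\<^sup>2 = 4 * (cmod (z - w))\<^sup>2 / ((cmod (z - 1))\<^sup>2 * (cmod (w - 1))\<^sup>2)"
    by (simp add: norm_mult norm_divide power_mult_distrib power_divide)
  then have "(cmod (cayley z - cayley w))\<^sup>2 / (2 * Im (cayley z) * Im (cayley w)) =
    2 * (cmod (z - w))\<^sup>2 / ((1 - (cmod z)\<^sup>2) * (1 - (cmod w)\<^sup>2))"
    using p by (simp add: Im_cayley 1 del: right_diff_distrib_numeral)
  then show ?thesis by (simp add: hyp_dist_def)
qed

section \<open>The signed distance between horocycles\<close>

lemma ball_Collect_cayley: "{z \<in> ball 0 1. P (cayley z)} = cayley_inv ` {\<zeta>. Im \<zeta> > 0 \<and> P \<zeta>}"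
proof (intro set_eqI iffI)
  fix z assume "z \<in> {z \<in> ball 0 1. P (cayley z)}"
  then have "z \<noteq> 1" "Im (cayley z) > 0" "P (cayley z)" using Im_cayley_pos[of z] by auto
  then show "z \<in> cayley_inv ` {\<zeta>. Im \<zeta> > 0 \<and> P \<zeta>}"
    by (intro image_eqI[of _ _ "cayley z"]) (simp_all add: cayley_inv_cayley)
next
  fix z assume "z \<in> cayley_inv ` {\<zeta>. Im \<zeta> > 0 \<and> P \<zeta>}"
  then obtain \<zeta> where "z = cayley_inv \<zeta>" "Im \<zeta> > 0" "P \<zeta>" by auto
  moreover from this have "\<zeta> \<noteq> - \<i>" by auto
  ultimately show "z \<in> {z \<in> ball 0 1. P (cayley z)}"
    using cayley_inv_in_ball[of \<zeta>] by (simp add: cayley_cayley_inv)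
qed

text \<open>The horocycle centered at \<open>circ U\<close>, for a vector \<open>U\<close> with \<open>Im U = 1\<close>, or with \<open>Im U = 0\<close>
  for the center \<open>1\<close>.\<close>

definition horo :: "complex \<Rightarrow> real \<Rightarrow> complex set" where
  "horo U L = {z \<in> ball 0 1. if Im U = 0 then Im (cayley z) = exp L
     else cayley z \<in> H_horocycle (Re U) (exp (- L))}"

text \<open>This is the formula of \<open>signed_length\<close> for arbitrary sets, which separates
  the geometry of two horocycles from the map \<open>h\<close>.\<close>

definition signed_dist :: "complex set \<Rightarrow> complex set \<Rightarrow> complex set \<Rightarrow> real" where
  "signed_dist A B g =
     (let l = hyp_dist (the_elem (A \<inter> g)) (the_elem (B \<inter> g)) in if A \<inter> B = {} then l else - l)"

lemma signed_dist_commute: "signed_dist A B g = signed_dist B A g"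
  by (simp add: signed_dist_def hyp_dist_def norm_minus_commute Int_commute mult.commute)

lemma arcosh_half_sum:
  assumes "K > (0 :: real)"
  shows "arcosh ((K + 1 / K) / 2) = \<bar>ln K\<bar>"
proof -
  have "(K + 1 / K) / 2 = cosh \<bar>ln K\<bar>"
    using assms by (simp add: abs_if cosh_ln_real inverse_eq_divide)
  then show ?thesis by (simp only: arcosh_cosh_real abs_ge_zero)
qed

text \<open>Everything is checked in the half-plane. The distance is \<open>\<bar>ln K\<bar>\<close>
  by \<open>arcosh_half_sum\<close>; the horocycles meet iff \<open>ln K\<close> is not positive, so
  the sign rule gives \<open>ln K\<close>.\<close>

lemma signed_dist_eqI:
  assumes A: "A = {z \<in> ball 0 1. P (cayley z)}" and B: "B = {z \<in> ball 0 1. Q (cayley z)}"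
    and g: "g = {z \<in> ball 0 1. R (cayley z)}"
    and 1: "\<And>\<zeta>. Im \<zeta> > 0 \<and> P \<zeta> \<and> R \<zeta> \<longleftrightarrow> \<zeta> = \<alpha>"
    and 2: "\<And>\<zeta>. Im \<zeta> > 0 \<and> Q \<zeta> \<and> R \<zeta> \<longleftrightarrow> \<zeta> = \<beta>"
    and dist: "1 + (cmod (\<alpha> - \<beta>))\<^sup>2 / (2 * Im \<alpha> * Im \<beta>) = (K + 1 / K) / 2"
    and K: "K > 0" and disj: "(\<exists>\<zeta>. Im \<zeta> > 0 \<and> P \<zeta> \<and> Q \<zeta>) \<longleftrightarrow> K \<le> 1"
  shows "signed_dist A B g = ln K"
proof -
  have "A \<inter> g = {z \<in> ball 0 1. P (cayley z) \<and> R (cayley z)}" using A g by auto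
  also have "\<dots> = {cayley_inv \<alpha>}"
    unfolding ball_Collect_cayley[of "\<lambda>\<zeta>. P \<zeta> \<and> R \<zeta>"] 1 by simp
  finally have Ag: "A \<inter> g = {cayley_inv \<alpha>}" .
  have "B \<inter> g = {z \<in> ball 0 1. Q (cayley z) \<and> R (cayley z)}" using B g by auto
  also have "\<dots> = {cayley_inv \<beta>}"
    unfolding ball_Collect_cayley[of "\<lambda>\<zeta>. Q \<zeta> \<and> R \<zeta>"] 2 by simp
  finally have Bg: "B \<inter> g = {cayley_inv \<beta>}" .
  have "A \<inter> B = {z \<in> ball 0 1. P (cayley z) \<and> Q (cayley z)}" using A B by auto
  also have "\<dots> = cayley_inv ` {\<zeta>. Im \<zeta> > 0 \<and> P \<zeta> \<and> Q \<zeta>}"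
    by (rule ball_Collect_cayley)
  finally have AB: "A \<inter> B = {} \<longleftrightarrow> \<not> K \<le> 1"
    using disj by auto
  have pos: "Im \<alpha> > 0" "Im \<beta> > 0" using 1 2 by blast+
  then have "\<alpha> \<noteq> - \<i>" "\<beta> \<noteq> - \<i>" by auto
  with pos have "hyp_dist (cayley_inv \<alpha>) (cayley_inv \<beta>) = arcosh ((K + 1 / K) / 2)"
    unfolding hyp_dist_cayley[OF cayley_inv_in_ball[OF pos(1)] cayley_inv_in_ball[OF pos(2)]]
    by (simp only: cayley_cayley_inv dist not_False_eq_True)
  also have "\<dots> = \<bar>ln K\<bar>" using K by (rule arcosh_half_sum)
  finally show ?thesis
    using K by (auto simp: signed_dist_def Ag Bg AB Let_def)
qed

lemma H_horocycle_iff: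
  assumes "\<delta> > 0"
  shows "\<zeta> \<in> H_horocycle x \<delta> \<longleftrightarrow> Im \<zeta> > 0 \<and> (Re \<zeta> - x)\<^sup>2 + (Im \<zeta>)\<^sup>2 = \<delta> * Im \<zeta>"
proof -
  have "dist (Complex x (\<delta> / 2)) \<zeta> = \<delta> / 2 \<longleftrightarrow> (dist (Complex x (\<delta> / 2)) \<zeta>)\<^sup>2 = (\<delta> / 2)\<^sup>2"
    using assms by (simp add: power2_eq_iff_nonneg)
  also have "\<dots> \<longleftrightarrow> (Re \<zeta> - x)\<^sup>2 + (Im \<zeta>)\<^sup>2 = \<delta> * Im \<zeta>"
    by (simp add: dist_norm cmod_power2) (auto simp: power2_eq_square algebra_simps)
  finally show ?thesis by (auto simp: H_horocycle_def)
qed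

text \<open>The vertical line over \<open>Re W\<close> meets the horocycles at the heights
  \<open>exp L\<close> and \<open>exp (- L')\<close>; \<open>K\<close> is the quotient of the
  heights.\<close>

lemma signed_dist_vertical:
  assumes U: "Im U = 0" "Re U \<noteq> 0" and W: "Im W = 1"
  shows "signed_dist (horo U L) (horo W L') (geodesic (circ U) (circ W)) = L + L'"
proof -
  define x where "x = Re W"
  have det: "det2 U W \<noteq> 0" using U W by (simp add: det2_eq)
  have "signed_dist (horo U L) (horo W L') (geodesic (circ U) (circ W)) = ln (exp (L + L'))"
  proof (rule signed_dist_eqI[where \<alpha> = "Complex x (exp L)" and \<beta> = "Complex x (exp (- L'))"])
    show "horo U L = {z \<in> ball 0 1. Im (cayley z) = exp L}"
      using U by (simp add: horo_def)
    show "horo W L' = {z \<in> ball 0 1. cayley z \<in> H_horocycle x (exp (- L'))}"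
      using W by (simp add: horo_def x_def)
    show "geodesic (circ U) (circ W) = {z \<in> ball 0 1. Re (cayley z) = x}"
    proof -
      have "Im U * Im W * (cmod \<zeta>)\<^sup>2 - (Re U * Im W + Im U * Re W) * Re \<zeta> + Re U * Re W
          = Re U * (x - Re \<zeta>)" for \<zeta>
        unfolding U(1) W x_def by (simp add: algebra_simps)
      then show ?thesis using geodesic_circ_iff[OF det] U(2) by (intro set_eqI) auto
    qed
    show "0 < Im \<zeta> \<and> Im \<zeta> = exp L \<and> Re \<zeta> = x \<longleftrightarrow> \<zeta> = Complex x (exp L)" for \<zeta>
      by (auto simp: complex_eq_iff)
    show "0 < Im \<zeta> \<and> \<zeta> \<in> H_horocycle x (exp (- L')) \<and> Re \<zeta> = x \<longleftrightarrow> \<zeta> = Complex x (exp (- L'))" for \<zeta>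
    proof -
      have "(Re \<zeta> - x)\<^sup>2 + (Im \<zeta>)\<^sup>2 = exp (- L') * Im \<zeta> \<longleftrightarrow> Im \<zeta> = exp (- L')"
        if "Re \<zeta> = x" "Im \<zeta> > 0"
        using that by (simp add: power2_eq_square)
      then show ?thesis
        unfolding H_horocycle_iff[OF exp_gt_zero] complex_eq_iff complex.sel
        using exp_gt_zero[of "- L'"] by metis
    qed
    show "1 + (cmod (Complex x (exp L) - Complex x (exp (- L'))))\<^sup>2 /
        (2 * Im (Complex x (exp L)) * Im (Complex x (exp (- L')))) = (exp (L + L') + 1 / exp (L + L')) / 2"
    proof -
      define a b where ab: "a = exp L" "b = exp (- L')"
      have pos: "a > 0" "b > 0" by (simp_all add: ab)
      have K: "exp (L + L') = a / b" by (simp add: ab exp_add exp_minus divide_inverse)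
      show ?thesis unfolding K ab[symmetric] using pos
        by (simp add: cmod_power2) (simp add: field_simps power2_eq_square)
    qed
    show "(\<exists>\<zeta>. 0 < Im \<zeta> \<and> Im \<zeta> = exp L \<and> \<zeta> \<in> H_horocycle x (exp (- L'))) \<longleftrightarrow> exp (L + L') \<le> 1"
    proof
      assume "\<exists>\<zeta>. 0 < Im \<zeta> \<and> Im \<zeta> = exp L \<and> \<zeta> \<in> H_horocycle x (exp (- L'))"
      then obtain \<zeta> where "(Re \<zeta> - x)\<^sup>2 + (exp L)\<^sup>2 = exp (- L') * exp L"
        by (auto simp: H_horocycle_iff)
      then have "exp L * exp L \<le> exp (- L') * exp L"
        using zero_le_power2[of "Re \<zeta> - x"] by (simp only: power2_eq_square)
      then show "exp (L + L') \<le> 1" by simp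
    next
      assume "exp (L + L') \<le> 1"
      then have "exp L * exp L \<le> exp (- L') * exp L" by simp
      \<comment> \<open>The witness solves the equation of the circle at height \<open>exp L\<close>
        for the real part.\<close>
      then have "Complex (x + sqrt (exp (- L') * exp L - exp L * exp L)) (exp L) \<in> H_horocycle x (exp (- L'))"
        by (simp add: H_horocycle_iff power2_eq_square)
      then show "\<exists>\<zeta>. 0 < Im \<zeta> \<and> Im \<zeta> = exp L \<and> \<zeta> \<in> H_horocycle x (exp (- L'))"
        by (intro exI conjI) auto
    qed
  qed simp
  then show ?thesis by simp
qed

text \<open>In the coordinate \<open>X = Re \<zeta> - x\<close>, the horocycle and the geodesic have the equations
  \<open>X^2 + Y^2 = \<delta> Y\<close> and \<open>X (X - l) + Y^2 = 0\<close>.\<close>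

lemma horocycle_geodesic_point:
  fixes X Y \<delta> l :: real
  assumes "\<delta> > 0" "l \<noteq> 0"
  shows "Y > 0 \<and> X\<^sup>2 + Y\<^sup>2 = \<delta> * Y \<and> X * (X - l) + Y\<^sup>2 = 0 \<longleftrightarrow>
    X = l * \<delta>\<^sup>2 / (\<delta>\<^sup>2 + l\<^sup>2) \<and> Y = l\<^sup>2 * \<delta> / (\<delta>\<^sup>2 + l\<^sup>2)"
    (is "?L \<longleftrightarrow> ?R")
proof
  have d: "\<delta>\<^sup>2 + l\<^sup>2 > 0" using assms by (simp add: sum_power2_gt_zero_iff)
  assume ?L
  then have Y: "Y > 0" and 1: "X\<^sup>2 + Y\<^sup>2 = \<delta> * Y" and 2: "X * (X - l) + Y\<^sup>2 = 0" by auto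
  \<comment> \<open>The difference of the two quadratic equations is linear.\<close>
  have 3: "X * l = \<delta> * Y" using 1 2 by (simp add: power2_eq_square algebra_simps)
  then have "X \<noteq> 0" using Y assms by auto
  have "X * (X * (\<delta>\<^sup>2 + l\<^sup>2)) = \<delta>\<^sup>2 * (X\<^sup>2 + Y\<^sup>2)"
    using 3 by (simp add: power2_eq_square algebra_simps) (metis mult.assoc mult.commute)
  also have "\<dots> = X * (l * \<delta>\<^sup>2)"
    unfolding 1 using 3 by (simp add: power2_eq_square algebra_simps)
  finally have "X * (\<delta>\<^sup>2 + l\<^sup>2) = l * \<delta>\<^sup>2" using \<open>X \<noteq> 0\<close> by simp
  then have X: "X = l * \<delta>\<^sup>2 / (\<delta>\<^sup>2 + l\<^sup>2)" using d by (metis less_irrefl nonzero_eq_divide_eq)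
  have "Y = X * l / \<delta>" using 3 assms by (simp add: field_simps)
  with X show ?R using assms by (simp add: power2_eq_square)
next
  have d: "\<delta>\<^sup>2 + l\<^sup>2 > 0" using assms by (simp add: sum_power2_gt_zero_iff)
  define D where "D = \<delta>\<^sup>2 + l\<^sup>2"
  assume ?R
  then have XY: "X = l * \<delta>\<^sup>2 / D" "Y = l\<^sup>2 * \<delta> / D" by (simp_all add: D_def)
  have D0: "D > 0" using d by (simp add: D_def)
  have Y: "Y > 0" using XY D0 assms by simp
  have "X\<^sup>2 + Y\<^sup>2 = (l\<^sup>2 * \<delta>\<^sup>2 * D) / (D * D)"
    unfolding XY by (simp add: D_def power2_eq_square add_divide_distrib[symmetric] algebra_simps)
  then have 1: "X\<^sup>2 + Y\<^sup>2 = \<delta> * Y" using D0 by (simp add: XY power2_eq_square)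
  have "X * l = \<delta> * Y" by (simp add: XY power2_eq_square)
  with 1 have "X * (X - l) + Y\<^sup>2 = 0" by (simp add: power2_eq_square algebra_simps)
  with 1 Y show ?L by blast
qed

text \<open>One direction is the Lagrange identity for the vectors \<open>(X, Y)\<close> and
  \<open>(X - l, Y)\<close>, whose determinant is \<open>l Y\<close> up to sign. For the other
  direction an intersection point is computed.\<close>

lemma horocycles_meet:
  fixes d1 d2 l :: real
  assumes "d1 > 0" "d2 > 0" "l \<noteq> 0"
  shows "(\<exists>X Y. Y > 0 \<and> X\<^sup>2 + Y\<^sup>2 = d1 * Y \<and> (X - l)\<^sup>2 + Y\<^sup>2 = d2 * Y) \<longleftrightarrow> l\<^sup>2 \<le> d1 * d2"
proof
  assume "\<exists>X Y. Y > 0 \<and> X\<^sup>2 + Y\<^sup>2 = d1 * Y \<and> (X - l)\<^sup>2 + Y\<^sup>2 = d2 * Y"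
  then obtain X Y where Y: "Y > 0" and 1: "X\<^sup>2 + Y\<^sup>2 = d1 * Y" and 2: "(X - l)\<^sup>2 + Y\<^sup>2 = d2 * Y" by blast
  have "l\<^sup>2 * Y\<^sup>2 \<le> (X * (X - l) + Y\<^sup>2)\<^sup>2 + l\<^sup>2 * Y\<^sup>2" by simp
  also have "\<dots> = (X\<^sup>2 + Y\<^sup>2) * ((X - l)\<^sup>2 + Y\<^sup>2)"
    by (simp add: power2_eq_square algebra_simps)
  also have "\<dots> = d1 * d2 * Y\<^sup>2" unfolding 1 2 by (simp add: power2_eq_square)
  finally show "l\<^sup>2 \<le> d1 * d2" using Y by simp
next
  assume le: "l\<^sup>2 \<le> d1 * d2"
  define R where "R = sqrt (d1 * d2 - l\<^sup>2)"
  have R: "R \<ge> 0" "R * R = d1 * d2 - l * l"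
    using le by (simp_all add: R_def power2_eq_square)
  define A where "A = (d1 - d2)\<^sup>2 + 4 * l\<^sup>2"
  have A: "A > 0" using assms by (simp add: A_def add_nonneg_pos)
  \<comment> \<open>Subtracting the circle equations gives \<open>X\<close> in terms of
    \<open>Y\<close>; substitution gives the equation \<open>quad\<close>. This is its larger root,
    which is visibly positive.\<close>
  define Y where "Y = l\<^sup>2 * (d1 + d2 + 2 * R) / A"
  define X where "X = (l\<^sup>2 + (d1 - d2) * Y) / (2 * l)"
  have AY: "A * Y = l\<^sup>2 * (d1 + d2 + 2 * R)" using A by (simp add: Y_def)
  have X: "2 * l * X = l\<^sup>2 + (d1 - d2) * Y" using assms by (simp add: X_def)
  have Y: "Y > 0" using A R assms by (simp add: Y_def add_pos_nonneg)
  have "A * (A * Y\<^sup>2 - 2 * l\<^sup>2 * (d1 + d2) * Y + l\<^sup>2 * l\<^sup>2)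
      = (A * Y)\<^sup>2 - 2 * l\<^sup>2 * (d1 + d2) * (A * Y) + A * (l\<^sup>2 * l\<^sup>2)"
    by (simp add: power2_eq_square algebra_simps)
  also have "\<dots> = l\<^sup>2 * l\<^sup>2 * (4 * (R * R) - (d1 + d2)\<^sup>2 + A)"
    unfolding AY by (simp add: power2_eq_square algebra_simps)
  also have "\<dots> = 0"
    unfolding R(2) A_def by (simp add: power2_eq_square algebra_simps)
  finally have quad: "A * Y\<^sup>2 - 2 * l\<^sup>2 * (d1 + d2) * Y + l\<^sup>2 * l\<^sup>2 = 0" using A by simp
  have "4 * l\<^sup>2 * (X\<^sup>2 + Y\<^sup>2 - d1 * Y) = (2 * l * X)\<^sup>2 + 4 * l\<^sup>2 * Y\<^sup>2 - 4 * l\<^sup>2 * d1 * Y"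
    by (simp add: power2_eq_square algebra_simps)
  also have "\<dots> = A * Y\<^sup>2 - 2 * l\<^sup>2 * (d1 + d2) * Y + l\<^sup>2 * l\<^sup>2"
    unfolding X A_def by (simp add: power2_eq_square algebra_simps)
  finally have 1: "X\<^sup>2 + Y\<^sup>2 = d1 * Y" using quad assms by simp
  then have "(X - l)\<^sup>2 + Y\<^sup>2 = d2 * Y"
    using X by (simp add: power2_eq_square algebra_simps)
  with 1 Y show "\<exists>X Y. Y > 0 \<and> X\<^sup>2 + Y\<^sup>2 = d1 * Y \<and> (X - l)\<^sup>2 + Y\<^sup>2 = d2 * Y" by blast
qed

text \<open>Both coordinate differences contain the factor \<open>d1 * d2 - l\<^sup>2\<close>, which
  vanishes at tangency. The squares of the cofactors add up to \<open>l\<^sup>2 * (D1 * D2)\<close>,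
  and this cancels one factor \<open>D1 * D2\<close>.\<close>

lemma horocycle_points_distance:
  fixes d1 d2 l :: real
  assumes "d1 > 0" "d2 > 0" "l \<noteq> 0"
  defines "D1 \<equiv> d1\<^sup>2 + l\<^sup>2" and "D2 \<equiv> d2\<^sup>2 + l\<^sup>2" and "K \<equiv> l\<^sup>2 / (d1 * d2)"
  shows "1 + ((l * d1\<^sup>2 / D1 - (l - l * d2\<^sup>2 / D2))\<^sup>2 + (l\<^sup>2 * d1 / D1 - l\<^sup>2 * d2 / D2)\<^sup>2)
      / (2 * (l\<^sup>2 * d1 / D1) * (l\<^sup>2 * d2 / D2)) = (K + 1 / K) / 2"
proof -
  have D: "D1 > 0" "D2 > 0" using assms by (simp_all add: add_pos_pos)
  have "l * d1\<^sup>2 / D1 - (l - l * d2\<^sup>2 / D2) = l * (d1\<^sup>2 * D2 - D1 * D2 + d2\<^sup>2 * D1) / (D1 * D2)"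
    using D by (simp add: field_simps)
  also have "d1\<^sup>2 * D2 - D1 * D2 + d2\<^sup>2 * D1 = (d1 * d2 - l\<^sup>2) * (d1 * d2 + l\<^sup>2)"
    by (simp add: D1_def D2_def power2_eq_square algebra_simps)
  finally have x: "l * d1\<^sup>2 / D1 - (l - l * d2\<^sup>2 / D2) = (d1 * d2 - l\<^sup>2) * (l * (d1 * d2 + l\<^sup>2)) / (D1 * D2)"
    by (simp add: mult_ac)
  have "l\<^sup>2 * d1 / D1 - l\<^sup>2 * d2 / D2 = l\<^sup>2 * (d1 * D2 - d2 * D1) / (D1 * D2)"
    using D by (simp add: field_simps)
  also have "d1 * D2 - d2 * D1 = (d1 * d2 - l\<^sup>2) * (d2 - d1)"
    by (simp add: D1_def D2_def power2_eq_square algebra_simps)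
  finally have y: "l\<^sup>2 * d1 / D1 - l\<^sup>2 * d2 / D2 = (d1 * d2 - l\<^sup>2) * (l\<^sup>2 * (d2 - d1)) / (D1 * D2)"
    by (simp add: mult_ac)
  have sq: "(E * a / D)\<^sup>2 + (E * b / D)\<^sup>2 = E\<^sup>2 * (a\<^sup>2 + b\<^sup>2) / D\<^sup>2" for E a b D :: real
    by (simp add: power_divide power_mult_distrib add_divide_distrib distrib_left)
  have "(l * d1\<^sup>2 / D1 - (l - l * d2\<^sup>2 / D2))\<^sup>2 + (l\<^sup>2 * d1 / D1 - l\<^sup>2 * d2 / D2)\<^sup>2
      = (d1 * d2 - l\<^sup>2)\<^sup>2 * ((l * (d1 * d2 + l\<^sup>2))\<^sup>2 + (l\<^sup>2 * (d2 - d1))\<^sup>2) / (D1 * D2)\<^sup>2"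
    unfolding x y by (rule sq)
  also have "(l * (d1 * d2 + l\<^sup>2))\<^sup>2 + (l\<^sup>2 * (d2 - d1))\<^sup>2 = l\<^sup>2 * (D1 * D2)"
    by (simp add: D1_def D2_def power2_eq_square algebra_simps)
  also have "(d1 * d2 - l\<^sup>2)\<^sup>2 * (l\<^sup>2 * (D1 * D2)) / (D1 * D2)\<^sup>2 = (d1 * d2 - l\<^sup>2)\<^sup>2 * l\<^sup>2 / (D1 * D2)"
    using D by (simp add: power2_eq_square)
  finally have n: "(l * d1\<^sup>2 / D1 - (l - l * d2\<^sup>2 / D2))\<^sup>2 + (l\<^sup>2 * d1 / D1 - l\<^sup>2 * d2 / D2)\<^sup>2
      = (d1 * d2 - l\<^sup>2)\<^sup>2 * l\<^sup>2 / (D1 * D2)" .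
  have "2 * (l\<^sup>2 * d1 / D1) * (l\<^sup>2 * d2 / D2) = 2 * l\<^sup>2 * l\<^sup>2 * (d1 * d2) / (D1 * D2)"
    by simp
  then have "((l * d1\<^sup>2 / D1 - (l - l * d2\<^sup>2 / D2))\<^sup>2 + (l\<^sup>2 * d1 / D1 - l\<^sup>2 * d2 / D2)\<^sup>2)
      / (2 * (l\<^sup>2 * d1 / D1) * (l\<^sup>2 * d2 / D2)) = (d1 * d2 - l\<^sup>2)\<^sup>2 / (2 * l\<^sup>2 * (d1 * d2))"
    unfolding n using D assms(1-3) by simp
  also have "1 + \<dots> = (K + 1 / K) / 2"
  proof -
    define e f where "e = d1 * d2" "f = l\<^sup>2"
    have "e > 0" "f > 0" using assms by (simp_all add: e_f_def)
    then show ?thesis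
      unfolding K_def e_f_def[symmetric] by (simp add: field_simps power2_eq_square)
  qed
  finally show ?thesis .
qed

lemma signed_dist_finite:
  assumes U: "Im U = 1" and W: "Im W = 1" and ne: "Re U \<noteq> Re W"
  shows "signed_dist (horo U L) (horo W L') (geodesic (circ U) (circ W))
    = 2 * ln (det2 U W) + L + L'"
proof -
  define x l d1 d2 where xl: "x = Re U" "l = Re W - Re U" "d1 = exp (- L)" "d2 = exp (- L')"
  define D1 D2 where D: "D1 = d1\<^sup>2 + l\<^sup>2" "D2 = d2\<^sup>2 + l\<^sup>2"
  define K where "K = l\<^sup>2 / (d1 * d2)"
  have pos: "d1 > 0" "d2 > 0" "l \<noteq> 0" using ne by (simp_all add: xl)
  have W': "Re W = x + l" by (simp add: xl)
  have det: "det2 U W = - l" using U W by (simp add: det2_eq xl)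
  have "signed_dist (horo U L) (horo W L') (geodesic (circ U) (circ W)) = ln K"
  proof (rule signed_dist_eqI[where \<alpha> = "Complex (x + l * d1\<^sup>2 / D1) (l\<^sup>2 * d1 / D1)"
        and \<beta> = "Complex (x + (l - l * d2\<^sup>2 / D2)) (l\<^sup>2 * d2 / D2)"])
    show "horo U L = {z \<in> ball 0 1. cayley z \<in> H_horocycle x d1}"
      using U by (simp add: horo_def xl)
    show "horo W L' = {z \<in> ball 0 1. cayley z \<in> H_horocycle (x + l) d2}"
      using W by (simp add: horo_def xl)
    show "geodesic (circ U) (circ W) =
        {z \<in> ball 0 1. (Re (cayley z) - x) * (Re (cayley z) - x - l) + (Im (cayley z))\<^sup>2 = 0}"
    proof -
      have "Im U * Im W * (cmod \<zeta>)\<^sup>2 - (Re U * Im W + Im U * Re W) * Re \<zeta> + Re U * Re W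
          = (Re \<zeta> - x) * (Re \<zeta> - x - l) + (Im \<zeta>)\<^sup>2" for \<zeta>
        unfolding W' U W xl(1)[symmetric] cmod_power2 by (simp add: power2_eq_square algebra_simps)
      moreover have "det2 U W \<noteq> 0" using det pos by simp
      ultimately show ?thesis using geodesic_circ_iff[of U W] by (intro set_eqI) simp
    qed
    show "0 < Im \<zeta> \<and> \<zeta> \<in> H_horocycle x d1 \<and> (Re \<zeta> - x) * (Re \<zeta> - x - l) + (Im \<zeta>)\<^sup>2 = 0 \<longleftrightarrow>
        \<zeta> = Complex (x + l * d1\<^sup>2 / D1) (l\<^sup>2 * d1 / D1)" for \<zeta>
      using horocycle_geodesic_point[OF pos(1,3), of "Im \<zeta>" "Re \<zeta> - x"] pos
      by (auto simp: H_horocycle_iff complex_eq_iff D)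
    show "0 < Im \<zeta> \<and> \<zeta> \<in> H_horocycle (x + l) d2 \<and> (Re \<zeta> - x) * (Re \<zeta> - x - l) + (Im \<zeta>)\<^sup>2 = 0 \<longleftrightarrow>
        \<zeta> = Complex (x + (l - l * d2\<^sup>2 / D2)) (l\<^sup>2 * d2 / D2)" for \<zeta>
    proof -
      \<comment> \<open>Measured backwards from the endpoint \<open>x + l\<close>, the second
        horocycle is in the position of the first.\<close>
      have "(Re \<zeta> - (x + l))\<^sup>2 = (x + l - Re \<zeta>)\<^sup>2"
        "(Re \<zeta> - x) * (Re \<zeta> - x - l) = (x + l - Re \<zeta>) * (x + l - Re \<zeta> - l)"
        by (simp_all add: power2_eq_square algebra_simps)
      then show ?thesis
        using horocycle_geodesic_point[OF pos(2,3), of "Im \<zeta>" "x + l - Re \<zeta>"] pos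
        by (auto simp: H_horocycle_iff complex_eq_iff D)
    qed
    show "1 + (cmod (Complex (x + l * d1\<^sup>2 / D1) (l\<^sup>2 * d1 / D1) -
          Complex (x + (l - l * d2\<^sup>2 / D2)) (l\<^sup>2 * d2 / D2)))\<^sup>2 /
        (2 * Im (Complex (x + l * d1\<^sup>2 / D1) (l\<^sup>2 * d1 / D1)) *
          Im (Complex (x + (l - l * d2\<^sup>2 / D2)) (l\<^sup>2 * d2 / D2))) = (K + 1 / K) / 2"
      using horocycle_points_distance[OF pos] unfolding D K_def
      by (simp add: cmod_power2)
    show "K > 0" using pos by (simp add: K_def)
    have "(\<exists>\<zeta>. 0 < Im \<zeta> \<and> \<zeta> \<in> H_horocycle x d1 \<and> \<zeta> \<in> H_horocycle (x + l) d2) \<longleftrightarrow>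
      (\<exists>X Y. Y > 0 \<and> X\<^sup>2 + Y\<^sup>2 = d1 * Y \<and> (X - l)\<^sup>2 + Y\<^sup>2 = d2 * Y)"
    proof
      assume "\<exists>\<zeta>. 0 < Im \<zeta> \<and> \<zeta> \<in> H_horocycle x d1 \<and> \<zeta> \<in> H_horocycle (x + l) d2"
      then obtain \<zeta> where "0 < Im \<zeta>" "\<zeta> \<in> H_horocycle x d1" "\<zeta> \<in> H_horocycle (x + l) d2" by blast
      then show "\<exists>X Y. Y > 0 \<and> X\<^sup>2 + Y\<^sup>2 = d1 * Y \<and> (X - l)\<^sup>2 + Y\<^sup>2 = d2 * Y"
        using pos by (intro exI[of _ "Re \<zeta> - x"] exI[of _ "Im \<zeta>"]) (simp add: H_horocycle_iff diff_diff_eq)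
    next
      assume "\<exists>X Y. Y > 0 \<and> X\<^sup>2 + Y\<^sup>2 = d1 * Y \<and> (X - l)\<^sup>2 + Y\<^sup>2 = d2 * Y"
      then obtain X Y where "Y > 0" "X\<^sup>2 + Y\<^sup>2 = d1 * Y" "(X - l)\<^sup>2 + Y\<^sup>2 = d2 * Y" by blast
      then show "\<exists>\<zeta>. 0 < Im \<zeta> \<and> \<zeta> \<in> H_horocycle x d1 \<and> \<zeta> \<in> H_horocycle (x + l) d2"
        using pos by (intro exI[of _ "Complex (x + X) Y"]) (simp add: H_horocycle_iff)
    qed
    also have "\<dots> \<longleftrightarrow> K \<le> 1"
      unfolding horocycles_meet[OF pos] using pos by (simp add: K_def)
    finally show "(\<exists>\<zeta>. 0 < Im \<zeta> \<and> \<zeta> \<in> H_horocycle x d1 \<and> \<zeta> \<in> H_horocycle (x + l) d2) \<longleftrightarrow> K \<le> 1" .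
  qed
  also have "ln K = 2 * ln l + L + L'"
    using pos by (simp add: K_def ln_div ln_mult ln_realpow) (simp add: xl)
  \<comment> \<open>By \<open>ln_minus\<close>, \<open>ln\<close> of a negative number is
    \<open>ln\<close> of its absolute value; so the sign of the determinant is immaterial.\<close>
  also have "ln l = ln (det2 U W)" unfolding det ln_minus ..
  finally show ?thesis .
qed

section \<open>The images of the Farey vertices\<close>

locale circle_homeo =
  fixes h :: "complex \<Rightarrow> complex"
  assumes h: "orientation_preserving_circle_homeo h"
    and h_1: "h 1 = 1" and h_m1: "h (- 1) = - 1"
begin

abbreviation \<phi> :: "real \<Rightarrow> real" where "\<phi> \<equiv> line_map h"

text \<open>A vector representing the image of the point \<open>circ u\<close>.\<close>

definition lift :: "complex \<Rightarrow> complex" where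
  "lift u = (if Im u = 0 then 1 else Complex (\<phi> (Re u / Im u)) 1)"

lemma h_inj: "cmod a = 1 \<Longrightarrow> cmod b = 1 \<Longrightarrow> h a = h b \<longleftrightarrow> a = b"
  using h unfolding orientation_preserving_circle_homeo_def homeomorphism_def
  by (metis dist_0_norm mem_sphere)

lemma h_norm: "cmod a = 1 \<Longrightarrow> cmod (h a) = 1"
  using h unfolding orientation_preserving_circle_homeo_def homeomorphism_def
  by (metis dist_0_norm imageI mem_sphere)

lemma h_ccw: "cmod a = 1 \<Longrightarrow> cmod b = 1 \<Longrightarrow> cmod c = 1 \<Longrightarrow> ccw a b c \<Longrightarrow> ccw (h a) (h b) (h c)"
  using h unfolding orientation_preserving_circle_homeo_def by simp

lemma lift_nonzero [simp]: "lift u \<noteq> 0"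
  by (simp add: lift_def complex_eq_iff)

lemma circle_eq_circ:
  assumes "cmod z = 1" "z \<noteq> 1"
  shows "z = circ (Complex (Re (cayley z)) 1)"
proof -
  have "Im (cayley z) = 0" using Im_cayley[OF assms(2)] assms(1) by simp
  then have "cayley z = of_real (Re (cayley z))" by (simp add: complex_eq_iff)
  then have "z = cayley_inv (of_real (Re (cayley z)))"
    using cayley_inv_cayley[OF assms(2)] by simp
  also have "\<dots> = circ (Complex (Re (cayley z)) 1)"
    by (simp add: cayley_inv_def circ_def Complex_eq)
  finally show ?thesis .
qed

lemma h_circ:
  assumes "u \<noteq> 0"
  shows "h (circ u) = circ (lift u)"
proof (cases "Im u = 0")
  case True
  with assms have "circ u = 1" by (intro circ_eqI) (auto simp: complex_eq_iff)
  moreover have "circ 1 = 1" by (simp add: circ_def)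
  ultimately show ?thesis using True h_1 by (simp add: lift_def)
next
  case False
  let ?c = "Complex (Re u / Im u) 1"
  have c: "?c \<noteq> 0" by (simp add: complex_eq_iff)
  have "det2 u ?c = 0" using False by (simp add: det2_eq)
  then have u: "circ u = circ ?c" using circ_eq_iff[OF assms c] by simp
  have "circ ?c \<noteq> circ 1" using c by (simp add: circ_eq_iff det2_eq)
  then have "circ ?c \<noteq> 1" by (simp add: circ_def)
  then have "h (circ ?c) \<noteq> 1" using h_inj[of "circ ?c" 1] h_1 c by simp
  then have "h (circ ?c) = circ (Complex (Re (cayley (h (circ ?c)))) 1)"
    using c h_norm[of "circ ?c"] by (intro circle_eq_circ) simp_all
  moreover have cinv: "circ ?c = cayley_inv (of_real (Re u / Im u))"
    by (simp add: cayley_inv_def circ_def Complex_eq)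
  have "\<phi> (Re u / Im u) = Re (cayley (h (circ ?c)))"
    by (simp only: line_map_def cinv)
  ultimately show ?thesis using False u by (simp add: lift_def)
qed

lemma det2_lift_nonzero:
  assumes "det2 u w \<noteq> 0"
  shows "det2 (lift u) (lift w) \<noteq> 0"
proof -
  have "u \<noteq> 0" "w \<noteq> 0" using assms by auto
  with assms h_inj[of "circ u" "circ w"] show ?thesis
    by (simp add: circ_eq_iff h_circ)
qed

text \<open>For real points, \<open>x < y\<close> says that infinity, \<open>x\<close>,
  \<open>y\<close> are in counterclockwise order, and \<open>h\<close> fixes the point over
  infinity.\<close>

lemma \<phi>_strict_mono: "x < y \<Longrightarrow> \<phi> x < \<phi> y"
proof -
  assume "x < y"
  have nz: "Complex x 1 \<noteq> 0" "Complex y 1 \<noteq> 0" by (simp_all add: complex_eq_iff)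
  have "ccw (circ 1) (circ (Complex x 1)) (circ (Complex y 1))"
    using nz \<open>x < y\<close> by (subst ccw_circ) (auto simp: det2_eq)
  then have "ccw (h (circ 1)) (h (circ (Complex x 1))) (h (circ (Complex y 1)))"
    using nz by (intro h_ccw) auto
  then have "ccw (circ (lift 1)) (circ (lift (Complex x 1))) (circ (lift (Complex y 1)))"
    using nz by (simp add: h_circ)
  then show ?thesis
    by (subst (asm) ccw_circ) (auto simp: det2_eq lift_def complex_eq_iff)
qed

lemma \<phi>_eq_iff [simp]: "\<phi> x = \<phi> y \<longleftrightarrow> x = y"
  using \<phi>_strict_mono by (metis linorder_neqE_linordered_idom order_less_irrefl)

lemma \<phi>_0: "\<phi> 0 = 0"
proof -
  have "cayley_inv 0 = - 1" by (simp add: cayley_inv_def)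
  then show ?thesis by (simp add: line_map_def h_m1 cayley_def)
qed

text \<open>If \<open>circ u\<close> is moved to infinity then the images of the neighbours \<open>circ w\<close> and
  \<open>circ (w + u)\<close> have distance \<open>exp (gap u w)\<close>, in units that depend on \<open>u\<close> only.\<close>

definition gap :: "complex \<Rightarrow> complex \<Rightarrow> real" where
  "gap u w = ln (det2 (lift w) (lift (w + u)) / (det2 (lift u) (lift w) * det2 (lift u) (lift (w + u))))"

section \<open>Shears as differences of logarithmic gaps\<close>

lemma gap_eq:
  assumes "det2 u w = 1"
  shows "gap u w = ln (det2 (lift w) (lift (w + u))) - ln (det2 (lift u) (lift w))
      - ln (det2 (lift u) (lift (w + u)))"
proof -
  have "det2 (lift w) (lift (w + u)) \<noteq> 0" "det2 (lift u) (lift w) \<noteq> 0"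
    "det2 (lift u) (lift (w + u)) \<noteq> 0"
    using assms by (auto intro!: det2_lift_nonzero simp: det2_swap[of w u])
  then show ?thesis by (simp add: gap_def ln_div ln_mult)
qed

text \<open>Since \<open>ln (- x) = ln x\<close>, all logarithms of determinants are those of
  absolute values. No signs of lifts have to be tracked.\<close>

lemma ln_det2_commute: "ln (det2 u w) = ln (det2 w u)"
  using det2_swap[of u w] by (simp add: ln_minus)

text \<open>With the pole at \<open>circ u\<close>, the cross ratio is the quotient of two
  consecutive gaps; the determinant of \<open>lift u\<close> and \<open>lift w\<close> occurs in
  both and cancels.\<close>

lemma shear_eq_gap:
  assumes uw: "u \<in> gint" "w \<in> gint" "det2 u w = 1"
  shows "shear h {circ u, circ w} = gap u w - gap u (w - u)"
proof -
  note nz = unimodular_nonzero[of u w]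
  have nz': "w + u \<noteq> 0" "w - u \<noteq> 0" "u \<noteq> 0" "w \<noteq> 0"
    using uw nz by (auto simp: add.commute)
  define a b c d where abcd: "a = lift u" "b = lift (w - u)" "c = lift w" "d = lift (w + u)"
  have det: "det2 b a \<noteq> 0" "det2 d c \<noteq> 0" "det2 c b \<noteq> 0" "det2 d a \<noteq> 0" "det2 a b \<noteq> 0" "det2 b c \<noteq> 0"
    using uw by (auto intro!: det2_lift_nonzero simp: abcd det2_swap[of w u])
  have "shear h {circ u, circ w} = ln (det2 b a * det2 d c / (det2 c b * det2 d a))"
    unfolding shear_circ[OF uw] using nz' by (simp add: h_circ cr_circ abcd)
  also have "\<dots> = ln (det2 b a) + ln (det2 d c) - (ln (det2 c b) + ln (det2 d a))"
    using det by (simp add: ln_div ln_mult)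
  also have "\<dots> = gap u w - gap u (w - u)"
    using uw ln_det2_commute[of b a] ln_det2_commute[of d c] ln_det2_commute[of c b] ln_det2_commute[of d a]
    by (simp add: gap_eq flip: abcd)
  finally show ?thesis .
qed

text \<open>Membership in \<open>P0_space\<close> says that the telescoping shears have total 0, so
  the gaps have one limit \<open>L\<close> in both directions. The one-sided sums at the edge are
  \<open>L - gap u w\<close> and \<open>gap u (w - u) - L\<close>.\<close>

lemma fan_gap_limit:
  assumes s: "shear h \<in> P0_space" and uw: "u \<in> gint" "w \<in> gint" "det2 u w = 1"
  obtains L where "((\<lambda>k. gap u (w + of_int k * u)) \<longlongrightarrow> L) at_top"
    "((\<lambda>k. gap u (w + of_int k * u)) \<longlongrightarrow> L) at_bot"
    "p_minus (shear h) (circ u) {circ u, circ w} - p_plus (shear h) (circ u) {circ u, circ w} =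
      gap u w + gap u (w - u) - 2 * L"
proof -
  obtain m where m: "\<And>n. fan (circ u) n = {circ u, circ (w + of_int (m + n) * u)}"
    using fan_shift[OF uw] by blast
  define G where "G k = gap u (w + of_int (m + k) * u)" for k
  have sG: "shear h (fan (circ u) n) = G n - G (n - 1)" for n
  proof -
    have "w + of_int (m + n) * u - u = w + of_int (m + (n - 1)) * u"
      by (simp add: algebra_simps)
    moreover have "w + of_int (m + n) * u \<in> gint" "det2 u (w + of_int (m + n) * u) = 1"
      using uw by (simp_all del: of_int_add)
    ultimately show ?thesis
      unfolding m G_def using shear_eq_gap[OF uw(1)] by metis
  qed
  have "tri u w \<in> farey_triangles" using uw by (simp add: tri_farey)
  then have "circ u \<in> farey_vertices" by (auto simp: farey_vertices_def tri_def)
  with s have "summable (\<lambda>k. shear h (fan (circ u) (- int (Suc k))))"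
    "summable (\<lambda>k. shear h (fan (circ u) (int k)))"
    "(\<Sum>k. shear h (fan (circ u) (- int (Suc k)))) + (\<Sum>k. shear h (fan (circ u) (int k))) = 0"
    unfolding P0_space_def P_space_def by blast+
  then have "summable (\<lambda>k. G (- int (Suc k)) - G (- int (Suc k) - 1))"
    "summable (\<lambda>k. G (int k) - G (int k - 1))"
    "(\<Sum>k. G (- int (Suc k)) - G (- int (Suc k) - 1)) + (\<Sum>k. G (int k) - G (int k - 1)) = 0"
    unfolding sG .
  then obtain L where L: "(G \<longlongrightarrow> L) at_top" "(G \<longlongrightarrow> L) at_bot"
    by (rule two_sided_telescoping_limit)
  have shift: "gap u (w + of_int k * u) = G (k - m)" for k by (simp add: G_def)
  have "filterlim (\<lambda>k::int. k - m) at_top at_top"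
    unfolding filterlim_at_top eventually_at_top_linorder
  proof
    fix Z show "\<exists>N. \<forall>n\<ge>N. Z \<le> n - m" by (rule exI[of _ "Z + m"]) auto
  qed
  then have L1: "((\<lambda>k. gap u (w + of_int k * u)) \<longlongrightarrow> L) at_top"
    unfolding shift by (rule filterlim_compose[OF L(1)])
  have "filterlim (\<lambda>k::int. k - m) at_bot at_bot"
    unfolding filterlim_at_bot eventually_at_bot_linorder
  proof
    fix Z show "\<exists>N. \<forall>n\<le>N. n - m \<le> Z" by (rule exI[of _ "Z + m"]) auto
  qed
  then have L2: "((\<lambda>k. gap u (w + of_int k * u)) \<longlongrightarrow> L) at_bot"
    unfolding shift by (rule filterlim_compose[OF L(2)])
  \<comment> \<open>The chosen indexing is shifted by \<open>m\<close>, so this edge has index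
    \<open>- m\<close>.\<close>
  have idx: "fan_index (circ u) {circ u, circ w} = - m"
    unfolding fan_index_def
  proof (rule the_equality)
    show "fan (circ u) (- m) = {circ u, circ w}" by (simp add: m)
    fix n assume "fan (circ u) n = {circ u, circ w}"
    then have "circ (w + of_int (m + n) * u) = circ (w + of_int 0 * u)"
      by (auto simp: m doubleton_eq_iff)
    from neighbour_inj[OF uw(3) this] show "n = - m" by simp
  qed
  have "p_plus (shear h) (circ u) {circ u, circ w} = L - G (- m)"
    unfolding p_plus_def idx sG using telescoping_at_top[OF L(1)] by (rule sums_unique[symmetric])
  moreover have "p_minus (shear h) (circ u) {circ u, circ w} = G (- m - 1) - L"
    unfolding p_minus_def idx sG using telescoping_at_bot[OF L(2)] by (rule sums_unique[symmetric])
  moreover have "G (- m) = gap u w" "G (- m - 1) = gap u (w - u)"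
    by (simp_all add: G_def)
  ultimately show thesis using that[OF L1 L2] by simp
qed

section \<open>Derivatives at the vertices and the decoration\<close>

lemma deriv_line_map_inf:
  assumes w: "Im w = 1"
    and L: "((\<lambda>k. gap 1 (w + of_int k * 1)) \<longlongrightarrow> L) at_top"
    "((\<lambda>k. gap 1 (w + of_int k * 1)) \<longlongrightarrow> L) at_bot"
  shows "deriv (line_map_inf h) 0 = exp (- L)"
proof -
  \<comment> \<open>The vertex is already at infinity and its neighbours are the points
    \<open>Re w + k\<close>, so \<open>gap\<close> is the logarithm of an increment of
    \<open>\<phi>\<close>.\<close>
  have gap: "gap 1 (w + of_int k * 1) = ln (\<phi> (Re w + 1 * of_int (k + 1)) - \<phi> (Re w + 1 * of_int k))" for k
  proof -
    have "gap 1 (w + of_int k * 1) = ln (\<phi> (Re w + of_int k) - \<phi> (Re w + of_int k + 1))"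
      by (simp add: gap_def lift_def det2_eq w)
    then show ?thesis
      using ln_minus[of "\<phi> (Re w + of_int k) - \<phi> (Re w + of_int k + 1)"]
      by (simp add: add.assoc)
  qed
  have "((\<lambda>t. \<phi> t / t) \<longlongrightarrow> exp L / 1) at_top"
    by (rule linear_growth_log_at_top[OF \<phi>_strict_mono _ L(1) gap]) simp_all
  moreover have "((\<lambda>t. \<phi> t / t) \<longlongrightarrow> exp L / 1) at_bot"
    by (rule linear_growth_log_at_bot[OF \<phi>_strict_mono _ L(2) gap]) simp_all
  ultimately have "((\<lambda>x. (- 1 / \<phi> (- 1 / x)) / x) \<longlongrightarrow> 1 / exp L) (at 0)"
    by (intro quotient_at_zero) simp_all
  \<comment> \<open>The value \<open>line_map_inf h 0\<close> is 0, by \<open>1 / 0 = 0\<close> and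
    \<open>\<phi> 0 = 0\<close>; so the limit above is that of the difference quotient.\<close>
  then have "(line_map_inf h has_field_derivative 1 / exp L) (at 0)"
    unfolding DERIV_def by (simp add: line_map_inf_def \<phi>_0)
  then show ?thesis
    by (simp add: DERIV_imp_deriv exp_minus inverse_eq_divide)
qed

text \<open>The neighbours of \<open>\<xi> = p / q\<close> are the points
  \<open>\<xi> - 1 / (c + q\<^sup>2 k)\<close>, a progression of step \<open>q\<^sup>2\<close> in
  the chart \<open>1 / (\<xi> - x)\<close>. Linear growth in this chart is differentiability at
  \<open>\<xi>\<close>, with the reciprocal slope as derivative.\<close>

lemma deriv_line_map:
  fixes p q :: real
  assumes u: "u = Complex p q" "q > 0" and uw: "det2 u w = 1"
    and L: "((\<lambda>k. gap u (w + of_int k * u)) \<longlongrightarrow> L) at_top"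
    "((\<lambda>k. gap u (w + of_int k * u)) \<longlongrightarrow> L) at_bot"
  shows "deriv \<phi> (p / q) = q\<^sup>2 * exp (- L)"
proof -
  define r s where rs: "r = Re w" "s = Im w"
  have w: "w = Complex r s" by (simp add: rs complex_eq_iff)
  have ps: "p * s - q * r = 1" using uw u w by (simp add: det2_eq)
  define \<xi> where "\<xi> = p / q"
  \<comment> \<open>This is \<open>\<phi>\<close> read in the charts \<open>1 / (\<xi> - x)\<close>
    and \<open>1 / (\<phi> \<xi> - y)\<close>.\<close>
  define g where "g t = - 1 / (\<phi> (\<xi> - 1 / t) - \<phi> \<xi>)" for t
  define c where "c = q * s"
  have m: "q\<^sup>2 > 0" using u by simp
  have lift_u: "lift u = Complex (\<phi> \<xi>) 1" using u by (simp add: lift_def \<xi>_def)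
  \<comment> \<open>An excluded index belongs to the neighbour at infinity, whose lift is
    \<open>1\<close>.\<close>
  have lift_k: "lift (w + of_int k * u) = Complex (\<phi> (\<xi> - 1 / (c + q\<^sup>2 * of_int k))) 1"
    if "c + q\<^sup>2 * of_int k \<noteq> 0" for k
  proof -
    have e: "c + q\<^sup>2 * of_int k = q * (s + of_int k * q)"
      by (simp add: c_def power2_eq_square algebra_simps)
    with that have ne: "s + of_int k * q \<noteq> 0" by auto
    have "p / q - 1 / (q * (s + of_int k * q)) = (p * (s + of_int k * q) - 1) / (q * (s + of_int k * q))"
      using ne u by (simp add: divide_simps)
    also have "p * (s + of_int k * q) - 1 = q * (r + of_int k * p)"
      using ps by (simp add: algebra_simps)
    finally have "p / q - 1 / (q * (s + of_int k * q)) = (r + of_int k * p) / (s + of_int k * q)"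
      using u by simp
    then show ?thesis using ne
      by (simp add: lift_def w u \<xi>_def e)
  qed
  have step: "c + q\<^sup>2 * of_int (k + 1) = c + q\<^sup>2 * of_int k + q\<^sup>2" for k :: int
    by (simp add: algebra_simps)
  have gap: "gap u (w + of_int k * u) =
      ln (g (c + q\<^sup>2 * of_int (k + 1)) - g (c + q\<^sup>2 * of_int k))"
    if ne: "c + q\<^sup>2 * of_int k \<noteq> 0" "c + q\<^sup>2 * of_int (k + 1) \<noteq> 0" for k
  proof -
    define x y where xy: "x = \<phi> (\<xi> - 1 / (c + q\<^sup>2 * of_int k)) - \<phi> \<xi>"
      "y = \<phi> (\<xi> - 1 / (c + q\<^sup>2 * of_int (k + 1))) - \<phi> \<xi>"
    have nz: "x \<noteq> 0" "y \<noteq> 0" using ne unfolding xy by (simp_all del: of_int_add)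
    have k1: "w + of_int k * u + u = w + of_int (k + 1) * u" by (simp add: algebra_simps)
    have "gap u (w + of_int k * u) = ln ((x - y) / (x * y))"
      unfolding gap_def k1 lift_k[OF ne(1)] lift_k[OF ne(2)] lift_u
      by (simp add: det2_eq xy algebra_simps)
    also have "(x - y) / (x * y) = - (- 1 / y - - 1 / x)"
      using nz by (simp add: field_simps)
    also have "ln \<dots> = ln (- 1 / y - - 1 / x)" by (rule ln_minus)
    finally show ?thesis by (simp add: g_def xy)
  qed
  have pos: "g x < g y" if "0 < x" "x < y" for x y
  proof -
    have "1 / y < 1 / x" "0 < 1 / y" using that by (simp_all add: field_simps)
    then have "\<phi> (\<xi> - 1 / x) < \<phi> (\<xi> - 1 / y)" "\<phi> (\<xi> - 1 / y) < \<phi> \<xi>"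
      by (auto intro!: \<phi>_strict_mono)
    then show ?thesis unfolding g_def by (simp add: field_simps)
  qed
  have neg: "g x < g y" if "x < y" "y < 0" for x y
  proof -
    have "1 / y < 1 / x" "1 / x < 0" using that by (simp_all add: field_simps)
    then have "\<phi> (\<xi> - 1 / x) < \<phi> (\<xi> - 1 / y)" "\<phi> \<xi> < \<phi> (\<xi> - 1 / x)"
      by (auto intro!: \<phi>_strict_mono)
    then show ?thesis unfolding g_def by (simp add: field_simps)
  qed
  have "((\<lambda>t. g t / t) \<longlongrightarrow> exp L / q\<^sup>2) at_top"
  proof (rule linear_growth_log_at_top[OF pos m L(1)])
    fix k :: int assume "c + q\<^sup>2 * of_int k > 0"
    with m step[of k] have "c + q\<^sup>2 * of_int k \<noteq> 0" "c + q\<^sup>2 * of_int (k + 1) \<noteq> 0"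
      by linarith+
    then show "gap u (w + of_int k * u) = ln (g (c + q\<^sup>2 * of_int (k + 1)) - g (c + q\<^sup>2 * of_int k))"
      by (rule gap)
  qed
  moreover have "((\<lambda>t. g t / t) \<longlongrightarrow> exp L / q\<^sup>2) at_bot"
  proof (rule linear_growth_log_at_bot[OF neg m L(2)])
    fix k :: int assume "c + q\<^sup>2 * of_int (k + 1) < 0"
    with m step[of k] have "c + q\<^sup>2 * of_int k \<noteq> 0" "c + q\<^sup>2 * of_int (k + 1) \<noteq> 0"
      by linarith+
    then show "gap u (w + of_int k * u) = ln (g (c + q\<^sup>2 * of_int (k + 1)) - g (c + q\<^sup>2 * of_int k))"
      by (rule gap)
  qed
  \<comment> \<open>Here \<open>- 1 / g (- 1 / x)\<close> is
    \<open>\<phi> (\<xi> + x) - \<phi> \<xi>\<close>.\<close>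
  ultimately have "((\<lambda>x. (- 1 / g (- 1 / x)) / x) \<longlongrightarrow> 1 / (exp L / q\<^sup>2)) (at 0)"
    using m by (intro quotient_at_zero) auto
  then have "(\<phi> has_field_derivative q\<^sup>2 * exp (- L)) (at \<xi>)"
    unfolding DERIV_def by (simp add: g_def exp_minus divide_inverse mult.commute)
  then show ?thesis by (simp add: DERIV_imp_deriv \<xi>_def)
qed

lemma lift_minus [simp]: "lift (- u) = lift u"
  by (simp add: lift_def)

lemma gap_minus: "gap (- u) (- w) = gap u w"
proof -
  have "- w + - u = - (w + u)" by simp
  then show ?thesis unfolding gap_def by (simp only: lift_minus)
qed

lemma decoration_infinity:
  assumes w: "Im w = 1"
    and L: "((\<lambda>k. gap 1 (w + of_int k * 1)) \<longlongrightarrow> L) at_top"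
    "((\<lambda>k. gap 1 (w + of_int k * 1)) \<longlongrightarrow> L) at_bot"
  shows "decoration h 1 = horo (lift 1) L"
  unfolding decoration_def deriv_line_map_inf[OF assms]
  by (simp add: horo_def lift_def exp_minus inverse_eq_divide)

text \<open>The factor \<open>q\<^sup>2\<close> of the derivative cancels the one in the diameter,
  which becomes \<open>exp (- L)\<close>.\<close>

lemma decoration_finite:
  fixes p q :: int
  assumes u: "u = Complex p q" "q > 0" and w: "w \<in> gint" "det2 u w = 1"
    and L: "((\<lambda>k. gap u (w + of_int k * u)) \<longlongrightarrow> L) at_top"
    "((\<lambda>k. gap u (w + of_int k * u)) \<longlongrightarrow> L) at_bot"
  shows "decoration h (circ u) = horo (lift u) L"
proof -
  have q: "real_of_int q > 0" "q \<noteq> 0" using u by auto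
  have deriv: "deriv \<phi> (p / q) = (real_of_int q)\<^sup>2 * exp (- L)"
    by (rule deriv_line_map[OF u(1) q(1) w(2) L])
  obtain r s :: int where rs: "Re w = r" "Im w = s"
    using w(1) by (auto simp: gint_def elim!: Ints_cases)
  have "real_of_int (p * s - q * r) = 1"
    using w(2) rs u(1) by (simp add: det2_eq)
  then have "p * s - q * r = 1" by (metis of_int_eq_1_iff)
  then have cop: "coprime p q"
    by (metis coprimeI dvd_diff dvd_mult2)
  have cay: "cayley (circ u) = of_real (p / q)"
    using cayley_circ[of u] q by (simp add: u)
  have "circ u \<noteq> 1"
    using circ_eq_iff[of u 1] q by (auto simp: u det2_eq complex_eq_iff circ_def)
  moreover have "(\<exists>p' q' :: int. coprime p' q' \<and> q' \<ge> 1 \<and>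
        cayley (circ u) = of_real (of_int p' / of_int q') \<and>
        cayley z \<in> H_horocycle (\<phi> (of_int p' / of_int q')) (\<bar>deriv \<phi> (of_int p' / of_int q')\<bar> / (of_int q')\<^sup>2))
      \<longleftrightarrow> cayley z \<in> H_horocycle (\<phi> (p / q)) (exp (- L))" for z
  proof
    assume "\<exists>p' q' :: int. coprime p' q' \<and> q' \<ge> 1 \<and>
        cayley (circ u) = of_real (of_int p' / of_int q') \<and>
        cayley z \<in> H_horocycle (\<phi> (of_int p' / of_int q')) (\<bar>deriv \<phi> (of_int p' / of_int q')\<bar> / (of_int q')\<^sup>2)"
    then obtain p' q' :: int where p'q': "coprime p' q'" "q' \<ge> 1"
      "cayley (circ u) = of_real (of_int p' / of_int q')"
      "cayley z \<in> H_horocycle (\<phi> (of_int p' / of_int q')) (\<bar>deriv \<phi> (of_int p' / of_int q')\<bar> / (of_int q')\<^sup>2)"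
      by blast
    then have eq: "real_of_int p / real_of_int q = real_of_int p' / real_of_int q'"
      unfolding cay of_real_eq_iff by simp
    then have "real_of_int (p * q') = real_of_int (p' * q)"
      using p'q'(2) q by (simp add: field_simps)
    \<comment> \<open>Both fractions are in lowest terms with positive denominators, so the
      denominators agree and \<open>decoration\<close> describes a single horocycle.\<close>
    then have "p * q' = p' * q" unfolding of_int_eq_iff .
    then have "\<bar>p\<bar> * \<bar>q'\<bar> = \<bar>p'\<bar> * \<bar>q\<bar>" by (metis abs_mult)
    then have "\<bar>q\<bar> = \<bar>q'\<bar>"
      using coprime_crossproduct_int[of p q p' q'] cop p'q'(1) by (metis coprime_commute)
    then have "q = q'" using u(2) p'q'(2) by simp
    then show "cayley z \<in> H_horocycle (\<phi> (p / q)) (exp (- L))"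
      using p'q'(4) q deriv unfolding eq[symmetric] by simp
  next
    assume "cayley z \<in> H_horocycle (\<phi> (p / q)) (exp (- L))"
    then show "\<exists>p' q' :: int. coprime p' q' \<and> q' \<ge> 1 \<and>
        cayley (circ u) = of_real (of_int p' / of_int q') \<and>
        cayley z \<in> H_horocycle (\<phi> (of_int p' / of_int q')) (\<bar>deriv \<phi> (of_int p' / of_int q')\<bar> / (of_int q')\<^sup>2)"
      using cop u(2) cay deriv q by (intro exI[of _ p] exI[of _ q]) simp
  qed
  ultimately show ?thesis
    using q by (simp add: decoration_def horo_def lift_def u)
qed

text \<open>The previous two lemmas treat \<open>Im u > 0\<close> and \<open>u = 1\<close>. Changing
  the signs of both \<open>u\<close> and \<open>w\<close> preserves points, lifts and gaps, and if
  \<open>Im u = 0\<close> then the determinant forces \<open>u\<close> to be 1 or -1.\<close>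

lemma decoration_eq:
  assumes uw: "u \<in> gint" "w \<in> gint" "det2 u w = 1"
    and L: "((\<lambda>k. gap u (w + of_int k * u)) \<longlongrightarrow> L) at_top"
    "((\<lambda>k. gap u (w + of_int k * u)) \<longlongrightarrow> L) at_bot"
  shows "decoration h (circ u) = horo (lift u) L"
proof -
  have upper: "decoration h (circ u) = horo (lift u) L"
    if u: "Im u > 0 \<or> u = 1" "u \<in> gint" and w: "w \<in> gint" "det2 u w = 1"
      and lim: "((\<lambda>k. gap u (w + of_int k * u)) \<longlongrightarrow> L) at_top"
      "((\<lambda>k. gap u (w + of_int k * u)) \<longlongrightarrow> L) at_bot" for u w
  proof (cases "u = 1")
    case True
    have "circ 1 = 1" by (simp add: circ_def)
    with w lim True decoration_infinity[of w L] show ?thesis by (simp add: det2_eq)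
  next
    case False
    obtain p q :: int where "Re u = p" "Im u = q"
      using u(2) by (auto simp: gint_def elim!: Ints_cases)
    then have "u = Complex p q" "q > 0" using u(1) False by (auto simp: complex_eq_iff)
    then show ?thesis using w lim by (intro decoration_finite)
  qed
  have neg: "gap (- u) (- w + of_int k * - u) = gap u (w + of_int k * u)" for k
    using gap_minus[of u "w + of_int k * u"] by simp
  have "Im u > 0 \<or> u = 1 \<or> Im (- u) > 0 \<or> - u = 1"
  proof (cases "Im u = 0")
    case True
    obtain p s :: int where ps: "Re u = p" "Im w = s"
      using uw by (auto simp: gint_def elim!: Ints_cases)
    then have "real_of_int (p * s) = 1" using uw(3) True by (simp add: det2_eq)
    then have "p * s = 1" by (metis of_int_eq_1_iff)
    then have "p = 1 \<or> p = - 1" by (auto simp: zmult_eq_1_iff)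
    then show ?thesis using ps True by (auto simp: complex_eq_iff)
  qed auto
  then consider "Im u > 0 \<or> u = 1" | "Im (- u) > 0 \<or> - u = 1" by blast
  then show ?thesis
  proof cases
    case 1
    with upper assms show ?thesis by blast
  next
    case 2
    have "decoration h (circ (- u)) = horo (lift (- u)) L"
      by (rule upper[OF 2, of "- w"]) (use uw L in \<open>simp_all only: neg gint_simps det2_simps minus_minus\<close>)
    then show ?thesis by simp
  qed
qed

section \<open>Signed lengths and the comparison with the shear sums\<close>

lemma signed_length_eq:
  assumes uw: "u \<in> gint" "w \<in> gint" "det2 u w = 1"
    and L: "((\<lambda>k. gap u (w + of_int k * u)) \<longlongrightarrow> L) at_top"
    "((\<lambda>k. gap u (w + of_int k * u)) \<longlongrightarrow> L) at_bot"
    and L': "((\<lambda>k. gap w (- u + of_int k * w)) \<longlongrightarrow> L') at_top"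
    "((\<lambda>k. gap w (- u + of_int k * w)) \<longlongrightarrow> L') at_bot"
  shows "signed_length h (circ u) (circ w) = 2 * ln (det2 (lift u) (lift w)) + L + L'"
proof -
  have nz: "u \<noteq> 0" "w \<noteq> 0" using unimodular_nonzero[of u w] uw by auto
  \<comment> \<open>At the other endpoint the basis is \<open>w\<close>, \<open>- u\<close>, which
    has determinant 1 again, and \<open>circ (- u) = circ u\<close>.\<close>
  have wu: "- u \<in> gint" "det2 w (- u) = 1" using uw by (simp_all add: det2_swap[of w u])
  have det: "det2 (lift u) (lift w) \<noteq> 0" using uw by (intro det2_lift_nonzero) simp
  have sl: "signed_length h (circ u) (circ w) =
      signed_dist (horo (lift u) L) (horo (lift w) L') (geodesic (circ (lift u)) (circ (lift w)))"
    using decoration_eq[OF uw L] decoration_eq[OF uw(2) wu L'] nz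
    by (simp add: signed_length_def signed_dist_def h_circ Let_def)
  show ?thesis
  proof (cases "Im u = 0")
    case True
    then have u: "lift u = 1" by (simp add: lift_def)
    \<comment> \<open>The determinant of the lifts is 1 here, so its logarithm contributes nothing,
      in accordance with \<open>signed_dist_vertical\<close>.\<close>
    then have "Im (lift w) = 1" using det by (auto simp: lift_def det2_eq split: if_splits)
    then show ?thesis
      unfolding sl u using signed_dist_vertical[of 1 "lift w" L L'] by (simp add: det2_eq)
  next
    case False
    then have u: "Im (lift u) = 1" by (simp add: lift_def)
    show ?thesis
    proof (cases "Im w = 0")
      case True
      then have w: "lift w = 1" by (simp add: lift_def)
      have g: "geodesic (circ (lift u)) (circ (lift w)) = geodesic (circ (lift w)) (circ (lift u))"
        using geodesic_circ_iff[OF det] geodesic_circ_iff[of "lift w" "lift u"] det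
        by (intro set_eqI) (simp add: det2_swap[of "lift w"] mult.commute add.commute)
      show ?thesis
        unfolding sl g signed_dist_commute[of "horo (lift u) L"]
        using signed_dist_vertical[of "lift w" "lift u" L' L] u
        by (simp add: w det2_eq ln_minus)
    next
      case False
      then have w: "Im (lift w) = 1" by (simp add: lift_def)
      moreover have "Re (lift u) \<noteq> Re (lift w)" using det u w by (simp add: det2_eq)
      ultimately show ?thesis unfolding sl using signed_dist_finite u by blast
    qed
  qed
qed

text \<open>In each of the two triangles at the edge, let \<open>x\<close> be the logarithmic
  determinant of the edge and \<open>y\<close>, \<open>z\<close> those of the other sides. Seen from
  the two endpoints the gaps are \<open>z - x - y\<close> and \<open>y - x - z\<close>, with sum
  \<open>- 2 x\<close>.\<close>

lemma sum_of_gaps: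
  assumes "det2 u w = 1"
  shows "gap u w + gap u (w - u) + gap w (- u) + gap w (- u - w) = - 4 * ln (det2 (lift u) (lift w))"
proof -
  have wu: "det2 w (- u) = 1" "det2 w (- u - w) = 1" "det2 u (w - u) = 1"
    using assms by (simp_all add: det2_swap[of w u])
  have "lift (- u - w) = lift (w + u)"
  proof -
    have "- u - w = - (w + u)" by simp
    then show ?thesis by (simp only: lift_minus)
  qed
  then show ?thesis
    using ln_det2_commute[of "lift w"] ln_det2_commute[of "lift (w - u)" "lift u"]
    unfolding gap_eq[OF assms] gap_eq[OF wu(1)] gap_eq[OF wu(2)] gap_eq[OF wu(3)]
    by (simp add: add.commute[of "- u"] ln_det2_commute[of "lift w" "lift u"]
        ln_det2_commute[of "lift (w - u)" "lift u"] ln_det2_commute[of "lift (w + u)" "lift u"])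
qed

lemma vartheta_eq:
  assumes s: "shear h \<in> P0_space" and uw: "u \<in> gint" "w \<in> gint" "det2 u w = 1"
  shows "vartheta h {circ u, circ w} = - (1 / 2) * signed_length h (circ u) (circ w)"
proof -
  have wu: "- u \<in> gint" "det2 w (- u) = 1" using uw by (simp_all add: det2_swap[of w u])
  have ne: "circ u \<noteq> circ w"
    using uw unimodular_nonzero[of u w] by (simp add: circ_eq_iff)
  obtain L where L: "((\<lambda>k. gap u (w + of_int k * u)) \<longlongrightarrow> L) at_top"
    "((\<lambda>k. gap u (w + of_int k * u)) \<longlongrightarrow> L) at_bot"
    and pu: "p_minus (shear h) (circ u) {circ u, circ w} - p_plus (shear h) (circ u) {circ u, circ w} =
      gap u w + gap u (w - u) - 2 * L"
    by (rule fan_gap_limit[OF s uw])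
  obtain L' where L': "((\<lambda>k. gap w (- u + of_int k * w)) \<longlongrightarrow> L') at_top"
    "((\<lambda>k. gap w (- u + of_int k * w)) \<longlongrightarrow> L') at_bot"
    and pw: "p_minus (shear h) (circ w) {circ w, circ (- u)} - p_plus (shear h) (circ w) {circ w, circ (- u)} =
      gap w (- u) + gap w (- u - w) - 2 * L'"
    by (rule fan_gap_limit[OF s uw(2) wu])
  have pw: "p_minus (shear h) (circ w) {circ u, circ w} - p_plus (shear h) (circ w) {circ u, circ w} =
      gap w (- u) + gap w (- u - w) - 2 * L'"
    using pw by (simp add: insert_commute)
  have "vartheta h {circ u, circ w} =
      1 / 4 * ((gap u w + gap u (w - u) - 2 * L) + (gap w (- u) + gap w (- u - w) - 2 * L'))"
    unfolding vartheta_def Psi_def using ne by (simp add: pu pw)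
  also have "\<dots> = - (1 / 2) * (2 * ln (det2 (lift u) (lift w)) + L + L')"
  proof -
    have "1 / 4 * ((a + b - 2 * c) + (a' + b' - 2 * c')) = - (1 / 2) * (2 * d + c + c')"
      if "a + b + a' + b' = - 4 * d" for a b c a' b' c' d :: real
      using that by (simp add: field_simps)
    then show ?thesis using sum_of_gaps[OF uw(3)] by blast
  qed
  finally show ?thesis
    unfolding signed_length_eq[OF uw L L'] .
qed

end

theorem corollary1p2:
  fixes h :: "complex \<Rightarrow> complex" and a b :: complex
  assumes "orientation_preserving_circle_homeo h"
    and "h (- 1) = - 1" and "h \<i> = \<i>" and "h 1 = 1"
    and "shear h \<in> P0_space"
    and "{a, b} \<in> farey_edges"
  shows "vartheta h {a, b} = - ln (Lambda h a b) \<and>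
         - ln (Lambda h a b) = - (1 / 2) * signed_length h a b"
proof -
  interpret circle_homeo h
    using assms by unfold_locales
  obtain u w where uw: "u \<in> gint" "w \<in> gint" "det2 u w = 1" and "{a, b} = {circ u, circ w}"
    using assms(6) unfolding farey_edges_eq by auto
  then consider "a = circ u" "b = circ w" | "a = circ w" "b = circ (- u)"
    by (auto simp: doubleton_eq_iff)
  then have "vartheta h {a, b} = - (1 / 2) * signed_length h a b"
  proof cases
    case 1
    with vartheta_eq[OF assms(5) uw] show ?thesis by simp
  next
    case 2
    have "- u \<in> gint" "det2 w (- u) = 1" using uw by (simp_all add: det2_swap[of w u])
    from vartheta_eq[OF assms(5) uw(2) this] 2 show ?thesis by simp
  qed
  then show ?thesis by (simp add: Lambda_def)
qed

end
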